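(* Let $Y\subset X$ be a compact right $U$-orbit and let $m=m(Y)$. Suppose that $f=\Phi\circ h_K$ is right $K$-invariant and that $R\in2\mathbb Z_{\ge0}$ and $\operatorname{supp}\Phi\subset\{0,2,\ldots,R\}$. If $n\in\mathbb Z_{\ge0}$ and $2(n-m)-2>R$, then $$\lambda^{\mathrm{per}}_{Y,n}(f)=\int_Xf\,d\mu_X.$$
   Context: Let $q$ be a prime power, $F=\mathbb F_q((t^{-1}))$, $\mathcal O=\mathbb F_q[[t^{-1}]]$, $\pi=t^{-1}$, $G=\mathrm{SL}_2(F)$, $\Gamma=\mathrm{SL}_2(\mathbb F_q[t])$, $K=\mathrm{SL}_2(\mathcal O)$, $X=\Gamma\backslash G$, $\mu_X$ the normalized $G$-invariant probability measure on $X$. Put $u(s)=\begin{pmatrix}1&s\\0&1\end{pmatrix}$, $U=\{u(s):s\in F\}$ acting on $X$ on the right, $a_n=\mathrm{diag}(t^n,t^{-n})$, and let $ds$ be Haar measure on $F$ with $ds(\mathcal O)=1$. For a compact orbit $Y=\Gamma gU$, the parameter stabilizer $\Lambda_U(Y)=\{s\in F:\Gamma gu(s)=\Gamma g\}$ is a cocompact lattice in $F$ independent of the choice of $g$, of covolume $q^{-2m-1}$ for a unique integer $m=:m(Y)$. $\nu_Y$ is the normalized $U$-invariant probability measure on $Y$, and $\lambda^{\mathrm{per}}_{Y,n}(f)=\int_Yf(ya_{-n})\,d\nu_Y(y)$. Height map: $\mathcal T$ is the Bruhat--Tits tree of $\mathrm{PGL}_2(F)$ (vertices: homothety classes of $\mathcal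 O$-lattices in $F^2$; $[L],[L']$ adjacent if representatives satisfy $\pi L\subsetneq L'\subsetneq L$, $L/L'\simeq\mathbb F_q$). With $v_n=[\mathrm{diag}(t^n,1)]\cdot[\mathcal O^2]$, the quotient of $\mathcal T$ by $\mathrm{PGL}_2(\mathbb F_q[t])$ is the ray $v_0-v_1-\cdots$, and $h(v)$ is the $n\ge0$ for which $v$ lies in the orbit of $v_n$. $h_K:X\to2\mathbb Z_{\ge0}$, $h_K(\Gamma g)=h(gv_0)$; $\Phi:2\mathbb Z_{\ge0}\to\mathbb C$. *)

theory Defs
  imports "HOL-Probability.Probability" "HOL-Computational_Algebra.Computational_Algebra"
begin

text \<open>
  The finite field \<open>\<F>\<^sub>q\<close> is a type \<open>'q\<close> of sort \<open>{field, finite}\<close>, so \<open>q = CARD('q)\<close>. The field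
  \<open>F = \<F>\<^sub>q((t\<^sup>-\<^sup>1))\<close> is \<open>'q fls\<close> with \<open>\<pi> = t\<^sup>-\<^sup>1\<close> as the Laurent variable \<^const>\<open>fls_X\<close>, and \<open>t\<close> is
  \<^const>\<open>fls_X_inv\<close>. The library metric on \<open>'q fls\<close> induces the \<open>\<pi>\<close>-adic topology; matrices carry the
  product topology.
\<close>

type_synonym 'q mat2 = "'q fls ^ 2 ^ 2"
type_synonym 'q coset = "'q mat2 set"

definition int_ring :: "'q::{field,finite} fls set" where
  "int_ring = range fps_to_fls"

definition poly_ring :: "'q::{field,finite} fls set" where
  "poly_ring = range (\<lambda>p. poly (map_poly fls_const p) fls_X_inv)"

definition mk_mat2 :: "'q fls \<Rightarrow> 'q fls \<Rightarrow> 'q fls \<Rightarrow> 'q fls \<Rightarrow> 'q::{field,finite} mat2" where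
  "mk_mat2 a b c d = vector [vector [a, b], vector [c, d]]"

definition SL2 :: "'q fls set \<Rightarrow> 'q::{field,finite} mat2 set" where
  "SL2 R = {A. (\<forall>i j. A $ i $ j \<in> R) \<and> det A = 1}"

definition GL2 :: "'q fls set \<Rightarrow> 'q::{field,finite} mat2 set" where
  "GL2 R = {A. (\<forall>i j. A $ i $ j \<in> R) \<and>
     (\<exists>B. (\<forall>i j. B $ i $ j \<in> R) \<and> A ** B = mat 1 \<and> B ** A = mat 1)}"

abbreviation G_grp :: "'q::{field,finite} mat2 set" where "G_grp \<equiv> SL2 UNIV"
abbreviation Gamma_grp :: "'q::{field,finite} mat2 set" where "Gamma_grp \<equiv> SL2 poly_ring"
abbreviation K_grp :: "'q::{field,finite} mat2 set" where "K_grp \<equiv> SL2 int_ring"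

definition u_mat :: "'q fls \<Rightarrow> 'q::{field,finite} mat2" where
  "u_mat s = mk_mat2 1 s 0 1"

definition a_mat :: "int \<Rightarrow> 'q::{field,finite} mat2" where
  "a_mat n = mk_mat2 (fls_X_inv powi n) 0 0 (fls_X_inv powi (- n))"

subsection \<open>The space \<open>X = \<Gamma>\G\<close>\<close>

definition Gamma_coset :: "'q::{field,finite} mat2 \<Rightarrow> 'q coset" where
  "Gamma_coset g = (\<lambda>\<gamma>. \<gamma> ** g) ` Gamma_grp"

definition X_space :: "'q::{field,finite} coset set" where
  "X_space = Gamma_coset ` G_grp"

definition right_act :: "'q::{field,finite} coset \<Rightarrow> 'q mat2 \<Rightarrow> 'q coset" where
  "right_act x g = (\<lambda>h. h ** g) ` x"

text \<open>The quotient topology of the subspace topology on \<open>G\<close>.\<close>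

definition X_top :: "'q::{field,finite} coset topology" where
  "X_top = topology (\<lambda>V. V \<subseteq> X_space \<and>
     openin (top_of_set G_grp) {g \<in> G_grp. Gamma_coset g \<in> V})"

lemma openin_X_top:
  "openin X_top V \<longleftrightarrow>
     V \<subseteq> X_space \<and> openin (top_of_set G_grp) {g \<in> G_grp. Gamma_coset g \<in> V}"
proof -
  have "istopology (\<lambda>V. V \<subseteq> (X_space :: 'a coset set) \<and>
     openin (top_of_set G_grp) {g \<in> G_grp. Gamma_coset g \<in> V})"
    unfolding istopology_def
  proof (intro conjI allI impI; (elim conjE)?)
    fix S T :: "'a coset set"
    assume "openin (top_of_set G_grp) {g \<in> G_grp. Gamma_coset g \<in> S}"
       and "openin (top_of_set G_grp) {g \<in> G_grp. Gamma_coset g \<in> T}"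
    then have "openin (top_of_set G_grp)
        ({g \<in> G_grp. Gamma_coset g \<in> S} \<inter> {g \<in> G_grp. Gamma_coset g \<in> T})"
      by (rule openin_Int)
    moreover have "{g \<in> G_grp. Gamma_coset g \<in> S \<inter> T} =
        {g \<in> G_grp. Gamma_coset g \<in> S} \<inter> {g \<in> G_grp. Gamma_coset g \<in> T}" by blast
    ultimately show "openin (top_of_set G_grp) {g \<in> G_grp. Gamma_coset g \<in> S \<inter> T}" by simp
  next
    fix \<K> :: "'a coset set set"
    assume *: "\<forall>V\<in>\<K>. V \<subseteq> X_space \<and> openin (top_of_set G_grp) {g \<in> G_grp. Gamma_coset g \<in> V}"
    have "{g \<in> G_grp. Gamma_coset g \<in> \<Union>\<K>} = (\<Union>V\<in>\<K>. {g \<in> G_grp. Gamma_coset g \<in> V})" by blast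
    with * show "openin (top_of_set G_grp) {g \<in> G_grp. Gamma_coset g \<in> \<Union>\<K>}" by auto
  qed blast+
  then show ?thesis unfolding X_top_def by (simp add: topology_inverse')
qed

lemma topspace_X_top: "topspace X_top = X_space"
proof -
  have "{g \<in> G_grp. Gamma_coset g \<in> (X_space :: 'a coset set)} = G_grp"
    by (auto simp: X_space_def)
  then have "openin X_top (X_space :: 'a coset set)" by (simp add: openin_X_top)
  then show ?thesis by (metis openin_X_top openin_subset openin_topspace subset_antisym)
qed

definition Borel_of :: "'b topology \<Rightarrow> 'b measure" where
  "Borel_of T = sigma (topspace T) {V. openin T V}"

text \<open>The next three predicates each pin down a unique measure: \<open>ds\<close>, \<open>\<mu>\<^sub>X\<close> and \<open>\<nu>\<^sub>Y\<close>.\<close>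

definition normalized_Haar :: "'q::{field,finite} fls measure \<Rightarrow> bool" where
  "normalized_Haar ds \<longleftrightarrow> sets ds = sets borel \<and>
     (\<forall>s. distr ds borel (\<lambda>x. s + x) = ds) \<and> emeasure ds int_ring = 1"

definition invariant_prob_X :: "'q::{field,finite} coset measure \<Rightarrow> bool" where
  "invariant_prob_X \<mu> \<longleftrightarrow> prob_space \<mu> \<and> sets \<mu> = sets (Borel_of X_top) \<and>
     (\<forall>g\<in>G_grp. distr \<mu> \<mu> (\<lambda>x. right_act x g) = \<mu>)"

definition invariant_prob_orbit ::
    "'q::{field,finite} coset set \<Rightarrow> 'q coset measure \<Rightarrow> bool" where
  "invariant_prob_orbit Y \<nu> \<longleftrightarrow> prob_space \<nu> \<and> sets \<nu> = sets (Borel_of (subtopology X_top Y)) \<and>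
     (\<forall>s. distr \<nu> \<nu> (\<lambda>y. right_act y (u_mat s)) = \<nu>)"

subsection \<open>Compact \<open>U\<close>-orbits\<close>

definition U_orbit :: "'q::{field,finite} coset \<Rightarrow> 'q coset set" where
  "U_orbit x = range (\<lambda>s. right_act x (u_mat s))"

definition compact_U_orbit :: "'q::{field,finite} coset set \<Rightarrow> bool" where
  "compact_U_orbit Y \<longleftrightarrow> (\<exists>g\<in>G_grp. Y = U_orbit (Gamma_coset g)) \<and> compactin X_top Y"

definition param_stabilizer :: "'q::{field,finite} coset \<Rightarrow> 'q fls set" where
  "param_stabilizer x = {s. right_act x (u_mat s) = x}"

text \<open>All points of \<open>Y\<close> have the same stabilizer because \<open>U\<close> is abelian.\<close>

definition Lambda_U :: "'q::{field,finite} coset set \<Rightarrow> 'q fls set" where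
  "Lambda_U Y = (THE L. \<forall>y\<in>Y. param_stabilizer y = L)"

text \<open>The covolume is the common measure of all Borel sets of representatives for \<open>F/\<Lambda>\<close>.\<close>

definition covolume :: "'q::{field,finite} fls measure \<Rightarrow> 'q fls set \<Rightarrow> ennreal" where
  "covolume ds L = (THE c. \<exists>D\<in>sets borel. (\<forall>s. \<exists>!d. d \<in> D \<and> s - d \<in> L) \<and> emeasure ds D = c)"

definition orbit_level :: "'q::{field,finite} fls measure \<Rightarrow> 'q coset set \<Rightarrow> int" where
  "orbit_level ds Y =
     (THE m. covolume ds (Lambda_U Y) = ennreal (real CARD('q) powi (- 2 * m - 1)))"

definition periodic_average ::
    "'q::{field,finite} coset measure \<Rightarrow> nat \<Rightarrow> ('q coset \<Rightarrow> complex) \<Rightarrow> complex" where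
  "periodic_average \<nu> n f = (LINT y|\<nu>. f (right_act y (a_mat (- int n))))"

subsection \<open>The height map\<close>

text \<open>
  A vertex of the Bruhat--Tits tree is the homothety class of an \<open>\<O>\<close>-lattice, i.e. of the
  \<open>\<O>\<close>-span of the columns of an invertible matrix, represented as the set of all its
  multiples by nonzero scalars. Orbits under \<open>PGL\<^sub>2(\<F>\<^sub>q[t])\<close> are orbits under \<open>GL\<^sub>2(\<F>\<^sub>q[t])\<close>, as
  scalars act trivially on vertices. The height only involves the vertices and these orbits,
  not adjacency.
\<close>

definition std_lattice :: "('q::{field,finite} fls ^ 2) set" where
  "std_lattice = {x. \<forall>i. x $ i \<in> int_ring}"

definition homothety_class ::
    "('q::{field,finite} fls ^ 2) set \<Rightarrow> ('q fls ^ 2) set set" where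
  "homothety_class L = {(\<lambda>x. c *s x) ` L | c. c \<noteq> 0}"

definition tree_vertices :: "('q::{field,finite} fls ^ 2) set set set" where
  "tree_vertices = {homothety_class ((\<lambda>x. A *v x) ` std_lattice) | A. invertible A}"

definition vertex_act ::
    "'q::{field,finite} mat2 \<Rightarrow> ('q fls ^ 2) set set \<Rightarrow> ('q fls ^ 2) set set" where
  "vertex_act g v = (\<lambda>L. (\<lambda>x. g *v x) ` L) ` v"

definition ray_vertex :: "nat \<Rightarrow> ('q::{field,finite} fls ^ 2) set set" where
  "ray_vertex n = vertex_act (mk_mat2 (fls_X_inv ^ n) 0 0 1) (homothety_class std_lattice)"

lemma vertex_act_homothety_class:
  "vertex_act g (homothety_class L) = homothety_class ((\<lambda>x. g *v x) ` L)"
proof -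
  have eq: "homothety_class M = (\<lambda>c. (\<lambda>x. c *s x) ` M) ` (- {0})" for M :: "('a fls ^ 2) set"
    by (auto simp: homothety_class_def)
  show ?thesis by (simp add: eq vertex_act_def image_image vector_scalar_commute)
qed

lemma vertex_act_in_tree_vertices:
  assumes "invertible g" "v \<in> tree_vertices"
  shows "vertex_act g v \<in> tree_vertices"
proof -
  from assms(2) obtain A where "invertible A" "v = homothety_class ((\<lambda>x. A *v x) ` std_lattice)"
    by (auto simp: tree_vertices_def)
  moreover from this assms(1) have "invertible (g ** A)" by (simp add: invertible_mult)
  ultimately show ?thesis
    by (auto simp: tree_vertices_def vertex_act_homothety_class image_image matrix_vector_mul_assoc)
qed

definition height :: "('q::{field,finite} fls ^ 2) set set \<Rightarrow> nat" where
  "height v = (THE n. \<exists>\<gamma>\<in>GL2 poly_ring. v = vertex_act \<gamma> (ray_vertex n))"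

definition height_K :: "'q::{field,finite} coset \<Rightarrow> nat" where
  "height_K x = (THE k. \<forall>g\<in>x. height (vertex_act g (ray_vertex 0)) = k)"

definition right_K_invariant :: "('q::{field,finite} coset \<Rightarrow> complex) \<Rightarrow> bool" where
  "right_K_invariant f \<longleftrightarrow> (\<forall>x\<in>X_space. \<forall>k\<in>K_grp. f (right_act x k) = f x)"

end

theory Submission
  imports Defs
begin

text \<open>
  The function \<open>f\<close> depends only on the height, so both integrals are determined by how the two
  measures distribute their mass over the levels \<open>k = 0, 1, 2, \<dots>\<close>, where level \<open>k\<close> is the set
  \<open>\<Gamma> a\<^sub>k K\<close> of points of height \<open>2 k\<close>. By the assumption on \<open>R\<close>, the function vanishes on
  the levels \<open>k \<ge> N\<close>, where \<open>N = n - m\<close>, so it is enough that the two distributions agree on all levels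
  \<open>k < N\<close>.

  Both distributions are forced by one local fact, the action of the Hecke operator of \<open>K a\<^sub>1 K\<close> on
  levels. The double coset consists of \<open>q\<^sup>2 + q\<close> left cosets of \<open>K\<close>, which in the tree are the
  vertices at distance \<open>2\<close>. From a point of level \<open>j \<ge> 1\<close> they lead once to level \<open>j + 1\<close>,
  \<open>q - 1\<close> times to level \<open>j\<close> and \<open>q\<^sup>2\<close> times to level \<open>j - 1\<close>; from level \<open>0\<close> they lead
  \<open>q + 1\<close> times to level \<open>1\<close> and \<open>q\<^sup>2 - 1\<close> times to level \<open>0\<close> (\<open>hecke_level_sum\<close>).

  For \<open>\<mu>\<^sub>X\<close>, invariance under \<open>G\<close> says that each Hecke neighbour of a random point is again distributed
  like that point, so the distribution on levels is stationary for this random walk. The walk moves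
  by at most one level, hence stationarity fixes the ratios of consecutive masses, and total mass
  \<open>1\<close> fixes the rest (\<open>level_prob_X\<close>).

  For \<open>Y\<close>, continuity of the height and compactness bound the height on \<open>Y\<close>. An orbit of bounded
  height is attached to a rational cusp: a lattice vector of tiny but nonzero first coordinate could
  be moved by some \<open>u(s)\<close> into a short vector, that is, into large height. Hence
  \<open>Y = \<Gamma> diag(\<alpha>, \<alpha>\<^sup>-\<^sup>1) U\<close> for some \<open>\<alpha>\<close> (\<open>compact_U_orbit_diagonal\<close>); its stabilizer is
  \<open>\<alpha>\<^sup>-\<^sup>2 \<F>\<^sub>q[t]\<close>, and comparing covolumes gives \<open>m = deg \<alpha>\<close> (\<open>orbit_level_diagonal\<close>). Let \<open>P\<^sub>N\<close>
  be the level distribution of \<open>y a\<^bsub>-(m+N)\<^esub>\<close> for random \<open>y\<close> in \<open>Y\<close>. The \<open>q\<^sup>2 + q\<close> Hecke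
  neighbours of \<open>y a\<^bsub>-(m+N)\<^esub>\<close> are, up to a translation by \<open>U\<close> that the invariance of \<open>\<nu>\<^sub>Y\<close>
  absorbs, \<open>q\<^sup>2\<close> points \<open>y a\<^bsub>-(m+N+1)\<^esub>\<close>, \<open>q - 1\<close> points \<open>y a\<^bsub>-(m+N)\<^esub>\<close> and one point
  \<open>y a\<^bsub>-(m+N-1)\<^esub>\<close>. Together with the Hecke action on levels this is a linear recursion in \<open>N\<close>. It
  starts with \<open>P\<^bsub>-1\<^esub>\<close> and \<open>P\<^sub>0\<close> concentrated on the levels \<open>1\<close> and \<open>0\<close>, because
  for \<open>n \<le> m\<close> every point \<open>y a\<^bsub>-n\<^esub>\<close> has level \<open>m - n\<close>. Its solution \<open>P\<^sub>N\<close> equals the stationary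
  distribution on the levels below \<open>N\<close> and puts the remaining mass on level \<open>N\<close>
  (\<open>horocycle_prob_unique\<close>, \<open>level_prob_orbit\<close>).
\<close>

(* "$" also denotes coefficients of power series; only its use for vector components is wanted. *)
no_notation fps_nth (infixl "$" 75)

section \<open>Laurent series: powers of the maximal ideal, and polynomials\<close>

text \<open>
  The fractional ideal \<open>\<pi>\<^sup>n \<O>\<close>. Using it instead of bounds on \<^const>\<open>fls_subdegree\<close> avoids the
  special case of \<open>0\<close>, whose subdegree is \<open>0\<close> and not infinite.
\<close>

definition pi_ideal :: "int \<Rightarrow> 'q::{field,finite} fls set" where
  "pi_ideal n = {x. \<forall>i<n. fls_nth x i = 0}"

lemma pi_ideal_0 [simp]: "0 \<in> pi_ideal n"
  by (simp add: pi_ideal_def)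

lemma pi_ideal_iff_subdegree: "x \<in> pi_ideal n \<longleftrightarrow> x = 0 \<or> n \<le> fls_subdegree x"
  using fls_subdegree_geI[of x n] by (auto simp: pi_ideal_def)

lemma pi_ideal_add: "x \<in> pi_ideal n \<Longrightarrow> y \<in> pi_ideal n \<Longrightarrow> x + y \<in> pi_ideal n"
  and pi_ideal_diff: "x \<in> pi_ideal n \<Longrightarrow> y \<in> pi_ideal n \<Longrightarrow> x - y \<in> pi_ideal n"
  and pi_ideal_uminus [simp]: "- x \<in> pi_ideal n \<longleftrightarrow> x \<in> pi_ideal n"
  by (auto simp: pi_ideal_def)

lemma pi_ideal_mono: "x \<in> pi_ideal m \<Longrightarrow> n \<le> m \<Longrightarrow> x \<in> pi_ideal n"
  by (auto simp: pi_ideal_def)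

lemma pi_ideal_mult:
  assumes "x \<in> pi_ideal m" "y \<in> pi_ideal n" "k \<le> m + n"
  shows "x * y \<in> pi_ideal k"
  using assms by (cases "x = 0 \<or> y = 0") (auto simp: pi_ideal_iff_subdegree)

lemma pi_ideal_inverse:
  "x \<noteq> 0 \<Longrightarrow> inverse x \<in> pi_ideal n \<longleftrightarrow> n \<le> - fls_subdegree x"
  by (simp add: pi_ideal_iff_subdegree)

lemma int_ring_eq_pi_ideal: "int_ring = pi_ideal 0"
proof (intro set_eqI iffI)
  fix x :: "'a fls" assume "x \<in> pi_ideal 0"
  then have "x = fps_to_fls (fls_regpart x)"
    by (intro fls_eqI) (auto simp: pi_ideal_def)
  then show "x \<in> int_ring" by (auto simp: int_ring_def)
qed (auto simp: int_ring_def pi_ideal_def)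

lemma X_inv_powi_nth: "fls_nth (fls_X_inv powi n :: 'q::{field,finite} fls) k = (if k = - n then 1 else 0)"
proof (cases "n \<ge> 0")
  case True
  then show ?thesis by (simp add: power_int_def)
next
  case False
  then show ?thesis by (simp add: power_int_def fls_inverse_X_inv)
qed

lemma X_inv_powi_subdegree [simp]: "fls_subdegree (fls_X_inv powi n :: 'q::{field,finite} fls) = - n"
  by (rule fls_subdegree_eqI) (auto simp: X_inv_powi_nth)

lemma mult_mem_pi_ideal_iff:
  "a \<noteq> 0 \<Longrightarrow> a * x \<in> pi_ideal n \<longleftrightarrow> x \<in> pi_ideal (n - fls_subdegree a)"
  by (cases "x = 0") (auto simp: pi_ideal_iff_subdegree)

lemma nonpos_support_mult:
  fixes x y :: "'q::{field,finite} fls"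
  assumes "\<And>i. i > 0 \<Longrightarrow> fls_nth x i = 0" "\<And>i. i > 0 \<Longrightarrow> fls_nth y i = 0" "n > 0"
  shows "fls_nth (x * y) n = 0"
proof -
  have "fls_nth x i * fls_nth y (n - i) = 0" for i
    using assms(1)[of i] assms(2)[of "n - i"] \<open>n > 0\<close> by (cases "i > 0") auto
  then show ?thesis
    unfolding fls_times_nth(2) by (intro sum.neutral ballI)
qed

text \<open>
  A Laurent series has only finitely many negative coefficients, so it is a polynomial in
  \<open>t = \<pi>\<^sup>-\<^sup>1\<close> as soon as its coefficients at positive powers of \<open>\<pi>\<close> vanish.
\<close>

lemma poly_ring_iff: "x \<in> poly_ring \<longleftrightarrow> (\<forall>i>0. fls_nth x i = 0)"
proof
  assume "x \<in> poly_ring"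
  then obtain p where p: "x = poly (map_poly fls_const p) fls_X_inv"
    by (auto simp: poly_ring_def)
  have "fls_nth (poly (map_poly fls_const p) fls_X_inv :: 'a fls) i = 0" if "i > 0" for i
    using that
  proof (induction p arbitrary: i)
    case (pCons a p)
    then show ?case
      by (simp add: map_poly_pCons nonpos_support_mult)
  qed simp
  with p show "\<forall>i>0. fls_nth x i = 0" by blast
next
  assume *: "\<forall>i>0. fls_nth x i = 0"
  have "x \<in> poly_ring" if "\<forall>i>0. fls_nth x i = 0" "\<forall>i < - int n. fls_nth x i = 0" for n
    using that
  proof (induction n arbitrary: x)
    case 0
    then have "x = poly (map_poly fls_const [:fls_nth x 0:]) fls_X_inv"
      by (intro fls_eqI) (auto simp: map_poly_pCons neq_iff)
    then show ?case unfolding poly_ring_def by (rule range_eqI)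
  next
    case (Suc n)
    define y where "y = fls_shift (-1) (x - fls_const (fls_nth x 0))"
    have "y \<in> poly_ring"
      by (rule Suc.IH) (use Suc.prems in \<open>auto simp: y_def neq_iff\<close>)
    then obtain p where p: "y = poly (map_poly fls_const p) fls_X_inv"
      by (auto simp: poly_ring_def)
    have "x = fls_const (fls_nth x 0) + fls_X_inv * y"
      by (simp add: y_def fls_X_inv_times_conv_shift)
    then have "x = poly (map_poly fls_const (pCons (fls_nth x 0) p)) fls_X_inv"
      by (simp add: p map_poly_pCons)
    then show ?case unfolding poly_ring_def by (rule range_eqI)
  qed
  moreover obtain n :: nat where "\<forall>i < - int n. fls_nth x i = 0"
  proof
    show "\<forall>i < - int (nat (- fls_subdegree x)). fls_nth x i = 0" by auto
  qed
  ultimately show "x \<in> poly_ring" using * by blast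
qed

lemma poly_ring_add: "x \<in> poly_ring \<Longrightarrow> y \<in> poly_ring \<Longrightarrow> x + y \<in> poly_ring"
  and poly_ring_diff: "x \<in> poly_ring \<Longrightarrow> y \<in> poly_ring \<Longrightarrow> x - y \<in> poly_ring"
  and poly_ring_uminus [simp]: "- x \<in> poly_ring \<longleftrightarrow> x \<in> poly_ring"
  and poly_ring_mult: "x \<in> poly_ring \<Longrightarrow> y \<in> poly_ring \<Longrightarrow> x * y \<in> poly_ring"
  by (auto simp: poly_ring_iff nonpos_support_mult)

lemma poly_ring_0_1_const [simp]: "0 \<in> poly_ring" "1 \<in> poly_ring" "fls_const c \<in> poly_ring"
  by (auto simp: poly_ring_iff)

lemma X_inv_powi_in_poly_ring: "n \<ge> 0 \<Longrightarrow> fls_X_inv powi n \<in> poly_ring"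
  by (auto simp: poly_ring_iff X_inv_powi_nth)

lemma poly_ring_pi_ideal_eq_0: "x \<in> poly_ring \<Longrightarrow> x \<in> pi_ideal n \<Longrightarrow> n > 0 \<Longrightarrow> x = 0"
  by (intro fls_eqI) (simp add: poly_ring_iff pi_ideal_def, meson not_less less_le_trans)

text \<open>
  Integral and fractional part: \<open>F = \<F>\<^sub>q[t] \<oplus> \<pi>\<O>\<close>. This is the division step of the reduction
  theory below and also gives the fundamental domain of \<open>\<F>\<^sub>q[t]\<close>.
\<close>

lemma poly_plus_pi_ideal:
  fixes x :: "'q::{field,finite} fls"
  obtains p r where "p \<in> poly_ring" "r \<in> pi_ideal 1" "x = p + r"
proof
  define r where "r = fls_shift (-1) (fps_to_fls (fls_regpart (fls_shift 1 x)))"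
  have "fls_nth r i = (if i > 0 then fls_nth x i else 0)" for i
    by (simp add: r_def)
  then show "x - r \<in> poly_ring" "r \<in> pi_ideal 1" "x = (x - r) + r"
    by (auto simp: poly_ring_iff pi_ideal_def)
qed

lemma countable_poly_ring: "countable (poly_ring :: 'q::{field,finite} fls set)"
proof -
  have "(UNIV :: 'q poly set) = range Poly"
    by (metis Poly_coeffs surjI)
  moreover have "countable (UNIV :: 'q list set)"
    using countable_lists[of "UNIV :: 'q set"] by (simp add: countable_finite)
  ultimately have "countable (UNIV :: 'q poly set)"
    by (metis countable_image)
  then show ?thesis by (simp add: poly_ring_def)
qed

section \<open>Matrices of size two\<close>

lemma mat2_exhaust: obtains a b c d where "A = mk_mat2 a b c d"
proof
  show "A = mk_mat2 (A$1$1) (A$1$2) (A$2$1) (A$2$2)"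
    by (simp add: mk_mat2_def vec_eq_iff forall_2)
qed

lemma mk_mat2_nth [simp]:
  "mk_mat2 a b c d $ 1 $ 1 = a" "mk_mat2 a b c d $ 1 $ 2 = b"
  "mk_mat2 a b c d $ 2 $ 1 = c" "mk_mat2 a b c d $ 2 $ 2 = d"
  by (simp_all add: mk_mat2_def)

lemma mk_mat2_eq_iff [simp]:
  "mk_mat2 a b c d = mk_mat2 a' b' c' d' \<longleftrightarrow> a = a' \<and> b = b' \<and> c = c' \<and> d = d'"
  by (metis mk_mat2_nth)

lemma mk_mat2_mult [simp]:
  "mk_mat2 a b c d ** mk_mat2 a' b' c' d' =
   mk_mat2 (a*a' + b*c') (a*b' + b*d') (c*a' + d*c') (c*b' + d*d')"
  by (simp add: vec_eq_iff forall_2 matrix_matrix_mult_def sum_2)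

lemma mat_1_eq_mk_mat2: "mat 1 = mk_mat2 1 0 0 1"
  by (simp add: vec_eq_iff forall_2 mat_def)

lemma det_mk_mat2 [simp]: "det (mk_mat2 a b c d) = a * d - b * c"
  by (simp add: det_2)

lemma mk_mat2_in_SL2_iff [simp]:
  "mk_mat2 a b c d \<in> SL2 R \<longleftrightarrow> a \<in> R \<and> b \<in> R \<and> c \<in> R \<and> d \<in> R \<and> a * d - b * c = 1"
  by (auto simp: SL2_def forall_2)

text \<open>
  The adjugate, which is the inverse on matrices of determinant \<open>1\<close>.
\<close>

definition mat2_inv :: "'q::{field,finite} mat2 \<Rightarrow> 'q mat2" where
  "mat2_inv A = mk_mat2 (A$2$2) (- (A$1$2)) (- (A$2$1)) (A$1$1)"

lemma mat2_inv_mk_mat2 [simp]: "mat2_inv (mk_mat2 a b c d) = mk_mat2 d (-b) (-c) a"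
  by (simp add: mat2_inv_def)

lemma mat2_inv_left: "A \<in> SL2 R \<Longrightarrow> mat2_inv A ** A = mat 1"
  by (cases A rule: mat2_exhaust) (auto simp: mat_1_eq_mk_mat2 algebra_simps)

lemma mat2_inv_right: "A \<in> SL2 R \<Longrightarrow> A ** mat2_inv A = mat 1"
  by (cases A rule: mat2_exhaust) (auto simp: mat_1_eq_mk_mat2 algebra_simps)

lemma mat2_inv_cancel:
  assumes "A \<in> SL2 R"
  shows "mat2_inv A ** (A ** B) = B" "A ** (mat2_inv A ** B) = B"
    "B ** mat2_inv A ** A = B" "B ** A ** mat2_inv A = B"
  using mat2_inv_left[OF assms] mat2_inv_right[OF assms]
  by (simp_all add: matrix_mul_assoc) (simp_all flip: matrix_mul_assoc)

lemma SL2_in_G: "A \<in> SL2 R \<Longrightarrow> A \<in> G_grp"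
  by (auto simp: SL2_def)

locale SL2_subring =
  fixes R :: "'q::{field,finite} fls set"
  assumes zero: "0 \<in> R" and one: "1 \<in> R"
    and add: "\<And>x y. x \<in> R \<Longrightarrow> y \<in> R \<Longrightarrow> x + y \<in> R"
    and neg: "\<And>x. x \<in> R \<Longrightarrow> - x \<in> R"
    and mult: "\<And>x y. x \<in> R \<Longrightarrow> y \<in> R \<Longrightarrow> x * y \<in> R"
begin

lemma mult_closed: "A \<in> SL2 R \<Longrightarrow> B \<in> SL2 R \<Longrightarrow> A ** B \<in> SL2 R"
proof -
  assume "A \<in> SL2 R" "B \<in> SL2 R"
  then have "det (A ** B) = 1" by (simp add: SL2_def det_mul)
  with \<open>A \<in> SL2 R\<close> \<open>B \<in> SL2 R\<close> show ?thesis
    by (auto simp: SL2_def forall_2 matrix_matrix_mult_def sum_2 intro!: add mult)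
qed

lemma inv_closed: "A \<in> SL2 R \<Longrightarrow> mat2_inv A \<in> SL2 R"
  by (cases A rule: mat2_exhaust) (auto simp: neg mult.commute)

lemma one_closed: "mat 1 \<in> SL2 R"
  by (simp add: mat_1_eq_mk_mat2 zero one)

end

interpretation Gam: SL2_subring poly_ring
  by unfold_locales (auto intro: poly_ring_add poly_ring_mult)

interpretation Kgp: SL2_subring int_ring
  by unfold_locales (auto simp: int_ring_eq_pi_ideal pi_ideal_iff_subdegree[of 1] intro: pi_ideal_add pi_ideal_mult)

interpretation Ggp: SL2_subring UNIV
  by unfold_locales auto

section \<open>The height of a vertex\<close>

lemma mat2_vec_mult [simp]:
  "(mk_mat2 a b c d *v x) $ 1 = a * x $ 1 + b * x $ 2"
  "(mk_mat2 a b c d *v x) $ 2 = c * x $ 1 + d * x $ 2"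
  by (simp_all add: matrix_vector_mult_def sum_2)

lemma std_lattice_iff: "x \<in> std_lattice \<longleftrightarrow> x $ 1 \<in> pi_ideal 0 \<and> x $ 2 \<in> pi_ideal 0"
  by (simp add: std_lattice_def forall_2 int_ring_eq_pi_ideal)

abbreviation ray_mat :: "nat \<Rightarrow> 'q::{field,finite} mat2" where
  "ray_mat n \<equiv> mk_mat2 (fls_X_inv ^ n) 0 0 1"

abbreviation lattice :: "'q::{field,finite} mat2 \<Rightarrow> ('q fls ^ 2) set" where
  "lattice A \<equiv> (\<lambda>x. A *v x) ` std_lattice"

lemma vertex_act_ray: "vertex_act \<gamma> (ray_vertex n) = homothety_class (lattice (\<gamma> ** ray_mat n))"
  by (simp add: ray_vertex_def vertex_act_homothety_class image_image matrix_vector_mul_assoc)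

lemma homothety_class_eqE:
  assumes "homothety_class L = homothety_class M"
  obtains c where "c \<noteq> 0" "L = (\<lambda>x. c *s x) ` M"
proof -
  have "L \<in> homothety_class L"
    by (auto simp: homothety_class_def intro!: exI[of _ 1])
  with assms show ?thesis using that by (auto simp: homothety_class_def)
qed

lemma homothety_class_scale:
  assumes "c \<noteq> 0"
  shows "homothety_class ((\<lambda>x. c *s x) ` M) = homothety_class M"
proof (intro set_eqI iffI)
  fix N assume "N \<in> homothety_class ((\<lambda>x. c *s x) ` M)"
  then obtain d where "d \<noteq> 0" "N = (\<lambda>x. (d * c) *s x) ` M"
    by (auto simp: homothety_class_def image_image)
  with assms show "N \<in> homothety_class M"
    by (auto simp: homothety_class_def intro!: exI[of _ "d * c"])
next
  fix N assume "N \<in> homothety_class M"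
  then obtain d where "d \<noteq> 0" "N = (\<lambda>x. d *s x) ` M"
    by (auto simp: homothety_class_def)
  with assms show "N \<in> homothety_class ((\<lambda>x. c *s x) ` M)"
    by (auto simp: homothety_class_def image_image intro!: exI[of _ "d / c"])
qed

lemma det_GL2_poly:
  fixes \<gamma> :: "'a::{field,finite} mat2"
  assumes "\<gamma> \<in> GL2 poly_ring"
  shows "det \<gamma> \<noteq> 0" "fls_subdegree (det \<gamma>) = 0"
proof -
  from assms obtain B :: "'a mat2" where B: "\<forall>i j. B $ i $ j \<in> poly_ring" "\<gamma> ** B = mat 1"
    and g: "\<forall>i j. \<gamma> $ i $ j \<in> poly_ring"
    by (auto simp: GL2_def)
  have prod: "det \<gamma> * det B = 1" using B(2) by (metis det_I det_mul)
  have "det C \<in> poly_ring" if "\<forall>i j. C $ i $ j \<in> poly_ring" for C :: "'a mat2"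
    using that by (auto simp: det_2 intro!: poly_ring_diff poly_ring_mult)
  with B g have *: "det \<gamma> \<in> poly_ring" "det B \<in> poly_ring" by auto
  from prod have nz: "det \<gamma> \<noteq> 0" "det B \<noteq> 0" by auto
  have "fls_subdegree x \<le> 0" if "x \<in> poly_ring" "x \<noteq> 0" for x :: "'a fls"
    using that by (metis nth_fls_subdegree_zero_iff poly_ring_iff not_less)
  with * nz have "fls_subdegree (det \<gamma>) \<le> 0" "fls_subdegree (det B) \<le> 0" by auto
  moreover have "fls_subdegree (det \<gamma>) + fls_subdegree (det B) = 0"
    using prod nz by (metis fls_subdegree_mult fls_one_subdegree)
  ultimately show "det \<gamma> \<noteq> 0" "fls_subdegree (det \<gamma>) = 0" using nz by auto
qed

text \<open>
  Comparing lattices along the ray. With \<open>e = - v\<close> the degree of \<open>z\<close>, each column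
  of \<open>\<gamma> diag(t\<^sup>n, 1)\<close> has a first entry of degree at most \<open>e + m\<close> and a second entry of degree at
  most \<open>e\<close>. The determinant then bounds \<open>n\<close>. In the case of equality with \<open>e > 0\<close>, the first column of \<open>\<gamma>\<close> consists of polynomials of
  negative degree, so it vanishes.
\<close>

lemma ray_lattice_subset:
  assumes \<gamma>: "\<gamma> \<in> GL2 poly_ring" and "z \<noteq> 0"
    and sub: "lattice (\<gamma> ** ray_mat n) \<subseteq> (\<lambda>x. z *s x) ` lattice (ray_mat m)"
  defines "v \<equiv> fls_subdegree z"
  shows "int n \<le> int m - 2 * v" and "int n = int m - 2 * v \<Longrightarrow> v \<ge> 0"
proof -
  obtain a b c d where abcd: "\<gamma> = mk_mat2 a b c d" by (rule mat2_exhaust)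
  have poly: "a \<in> poly_ring" "c \<in> poly_ring"
    using \<gamma> by (auto simp: GL2_def abcd forall_2)
  have col: "((\<gamma> ** ray_mat n) *v x) $ 1 \<in> pi_ideal (v - int m) \<and>
      ((\<gamma> ** ray_mat n) *v x) $ 2 \<in> pi_ideal v" if "x \<in> std_lattice" for x
  proof -
    from that sub obtain y where "y \<in> std_lattice" "(\<gamma> ** ray_mat n) *v x = z *s (ray_mat m *v y)"
      by (auto simp: subset_iff image_iff)
    then show ?thesis using \<open>z \<noteq> 0\<close>
      by (auto simp: std_lattice_iff v_def mult_mem_pi_ideal_iff intro: pi_ideal_mono)
  qed
  have e1: "(vector [1, 0] :: 'a fls ^ 2) \<in> std_lattice"
    and e2: "(vector [0, 1] :: 'a fls ^ 2) \<in> std_lattice"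
    by (auto simp: std_lattice_iff pi_ideal_iff_subdegree)
  have a: "a * fls_X_inv ^ n \<in> pi_ideal (v - int m)" and c: "c * fls_X_inv ^ n \<in> pi_ideal v"
    using col[OF e1] by (simp_all add: abcd)
  have b: "b \<in> pi_ideal (v - int m)" and d: "d \<in> pi_ideal v"
    using col[OF e2] by (simp_all add: abcd)
  have "a * fls_X_inv ^ n * d - b * (c * fls_X_inv ^ n) \<in> pi_ideal (2 * v - int m)"
    by (rule pi_ideal_diff) (rule pi_ideal_mult[OF a d] pi_ideal_mult[OF b c]; simp)+
  also have "a * fls_X_inv ^ n * d - b * (c * fls_X_inv ^ n) = det \<gamma> * fls_X_inv ^ n"
    by (simp add: abcd algebra_simps)
  finally show "int n \<le> int m - 2 * v"
    using det_GL2_poly[OF \<gamma>] by (simp add: pi_ideal_iff_subdegree)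
  show "v \<ge> 0" if n: "int n = int m - 2 * v"
  proof (rule ccontr)
    assume "\<not> v \<ge> 0"
    have "a \<in> pi_ideal (- v)" "c \<in> pi_ideal (int m - v)"
      using a c n mult_mem_pi_ideal_iff[of "fls_X_inv ^ n" a] mult_mem_pi_ideal_iff[of "fls_X_inv ^ n" c]
      by (auto simp: mult.commute elim!: pi_ideal_mono)
    with poly have "a = 0" "c = 0"
      using \<open>\<not> v \<ge> 0\<close> by (auto intro: poly_ring_pi_ideal_eq_0)
    with det_GL2_poly(1)[OF \<gamma>] show False by (simp add: abcd)
  qed
qed

text \<open>
  The vertices of the ray are pairwise inequivalent. An equivalence and its inverse give two
  inclusions of lattices with scalars \<open>z\<close> and \<open>z\<^sup>-\<^sup>1\<close>, so all inequalities of the preceding lemma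
  hold in both directions.
\<close>

lemma ray_vertex_orbit_inj:
  assumes \<gamma>: "\<gamma> \<in> GL2 poly_ring"
    and eq: "vertex_act \<gamma> (ray_vertex n) = ray_vertex m"
  shows "n = m"
proof -
  from \<gamma> obtain B where B: "\<gamma> ** B = mat 1" "B ** \<gamma> = mat 1" and BG: "B \<in> GL2 poly_ring"
    by (auto simp: GL2_def)
  have "ray_vertex m = homothety_class (lattice (ray_mat m))"
    using vertex_act_ray[of "mat 1" m] by (simp add: vertex_act_def)
  then have "homothety_class (lattice (\<gamma> ** ray_mat n)) = homothety_class (lattice (ray_mat m))"
    using eq by (simp add: vertex_act_ray)
  then obtain z where z: "z \<noteq> 0" and L: "lattice (\<gamma> ** ray_mat n) = (\<lambda>x. z *s x) ` lattice (ray_mat m)"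
    by (rule homothety_class_eqE)
  have "(\<lambda>x. B *v x) ` lattice (\<gamma> ** ray_mat n) = lattice (ray_mat n)"
    by (simp add: image_image matrix_vector_mul_assoc matrix_mul_assoc B)
  moreover have "(\<lambda>x. B *v x) ` (\<lambda>x. z *s x) ` lattice (ray_mat m) =
      (\<lambda>x. z *s x) ` lattice (B ** ray_mat m)"
    by (simp add: image_image matrix_vector_mul_assoc vector_scalar_commute)
  ultimately have "(\<lambda>x. z *s x) ` lattice (B ** ray_mat m) = lattice (ray_mat n)"
    using L by simp
  then have "(\<lambda>x. inverse z *s x) ` lattice (ray_mat n) =
      (\<lambda>x. inverse z *s x) ` (\<lambda>x. z *s x) ` lattice (B ** ray_mat m)"
    by (rule arg_cong[OF sym])
  also have "\<dots> = lattice (B ** ray_mat m)"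
    using z by (simp add: image_image)
  finally have L': "lattice (B ** ray_mat m) = (\<lambda>x. inverse z *s x) ` lattice (ray_mat n)"
    by (rule sym)
  have z': "inverse z \<noteq> 0" using z by simp
  note 1 = ray_lattice_subset[OF \<gamma> z equalityD1[OF L]]
  note 2 = ray_lattice_subset[OF BG z' equalityD1[OF L'], unfolded fls_inverse_subdegree]
  from 1(1) 2(1) have "int n = int m - 2 * fls_subdegree z" "int m = int n - 2 * - fls_subdegree z"
    by linarith+
  with 1(2) 2(2) show ?thesis by linarith
qed

lemma GL2_mult:
  fixes A B :: "'a::{field,finite} mat2"
  assumes "A \<in> GL2 poly_ring" "B \<in> GL2 poly_ring"
  shows "A ** B \<in> GL2 poly_ring"
proof -
  have cl: "\<forall>i j. (C ** D) $ i $ j \<in> poly_ring"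
    if "\<forall>i j. C $ i $ j \<in> poly_ring" "\<forall>i j. D $ i $ j \<in> poly_ring" for C D :: "'a mat2"
    using that by (auto simp: matrix_matrix_mult_def sum_2 intro!: poly_ring_add poly_ring_mult)
  from assms obtain A' B' :: "'a mat2" where *: "\<forall>i j. A' $ i $ j \<in> poly_ring" "A ** A' = mat 1" "A' ** A = mat 1"
      "\<forall>i j. B' $ i $ j \<in> poly_ring" "B ** B' = mat 1" "B' ** B = mat 1"
    by (auto simp: GL2_def)
  have "A ** B ** (B' ** A') = A ** (B ** B') ** A'" "B' ** A' ** (A ** B) = B' ** (A' ** A) ** B"
    by (simp_all add: matrix_mul_assoc)
  with * have "A ** B ** (B' ** A') = mat 1" "B' ** A' ** (A ** B) = mat 1"
    by (metis matrix_mul_rid)+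
  with * assms show ?thesis
    by (auto simp: GL2_def cl intro!: exI[of _ "B' ** A'"])
qed

lemma Gamma_subset_GL2: "\<gamma> \<in> Gamma_grp \<Longrightarrow> \<gamma> \<in> GL2 poly_ring"
  using Gam.inv_closed[of \<gamma>] mat2_inv_left[of \<gamma>] mat2_inv_right[of \<gamma>]
  by (auto simp: GL2_def SL2_def)

lemma height_orbit:
  assumes "\<gamma> \<in> GL2 poly_ring"
  shows "height (vertex_act \<gamma> (ray_vertex n)) = n"
  unfolding height_def
proof (rule the_equality)
  fix m assume "\<exists>\<gamma>'\<in>GL2 poly_ring. vertex_act \<gamma> (ray_vertex n) = vertex_act \<gamma>' (ray_vertex m)"
  then obtain \<gamma>' where \<gamma>': "\<gamma>' \<in> GL2 poly_ring"
    and eq: "vertex_act \<gamma> (ray_vertex n) = vertex_act \<gamma>' (ray_vertex m)" by blast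
  from \<gamma>' obtain B where B: "B ** \<gamma>' = mat 1" "B \<in> GL2 poly_ring"
    by (auto simp: GL2_def)
  have "vertex_act B (vertex_act A v) = vertex_act (B ** A) v" for A and v :: "('a fls ^ 2) set set"
    by (simp add: vertex_act_def image_image matrix_vector_mul_assoc)
  then have "vertex_act (B ** \<gamma>) (ray_vertex n) = vertex_act (B ** \<gamma>') (ray_vertex m)"
    using eq by metis
  also have "\<dots> = ray_vertex m"
    by (simp add: B vertex_act_def)
  finally show "m = n"
    using ray_vertex_orbit_inj[OF GL2_mult[OF B(2) assms]] by blast
qed (use assms in blast)

section \<open>Reduction theory: the level of a matrix\<close>

definition t_pow :: "int \<Rightarrow> 'q::{field,finite} fls" where
  "t_pow n = fls_X_inv powi n"

lemma t_pow_simps [simp]: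
  "t_pow 0 = 1" "t_pow n \<noteq> 0" "fls_subdegree (t_pow n) = - n"
  "t_pow m * t_pow n = t_pow (m + n)" "t_pow m * (t_pow n * x) = t_pow (m + n) * x"
  "inverse (t_pow n) = t_pow (- n)" "n \<ge> 0 \<Longrightarrow> t_pow n \<in> poly_ring"
  by (simp_all add: t_pow_def power_int_add power_int_minus X_inv_powi_in_poly_ring del: fls_subdegree_power_int)

definition diag_mat :: "'q::{field,finite} fls \<Rightarrow> 'q mat2" where
  "diag_mat \<alpha> = mk_mat2 \<alpha> 0 0 (inverse \<alpha>)"

definition l_mat :: "'q::{field,finite} fls \<Rightarrow> 'q mat2" where
  "l_mat s = mk_mat2 1 0 s 1"

definition weyl :: "'q::{field,finite} mat2" where
  "weyl = mk_mat2 0 (- 1) 1 0"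

lemma a_mat_eq_diag_mat: "a_mat n = diag_mat (t_pow n)"
  by (simp add: a_mat_def diag_mat_def t_pow_def power_int_minus)

lemmas mat_defs = diag_mat_def l_mat_def weyl_def u_mat_def

lemma elementary_mats_in_SL2 [simp]: "u_mat x \<in> G_grp" "l_mat x \<in> G_grp" "\<alpha> \<noteq> 0 \<Longrightarrow> diag_mat \<alpha> \<in> G_grp"
  "a_mat n \<in> G_grp" "weyl \<in> G_grp"
  "weyl \<in> Gamma_grp" "weyl \<in> K_grp"
  "u_mat x \<in> Gamma_grp \<longleftrightarrow> x \<in> poly_ring" "u_mat x \<in> K_grp \<longleftrightarrow> x \<in> pi_ideal 0"
  "l_mat x \<in> K_grp \<longleftrightarrow> x \<in> pi_ideal 0"
  by (auto simp: mat_defs a_mat_eq_diag_mat int_ring_eq_pi_ideal pi_ideal_iff_subdegree[of 1])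

lemma diag_mat_in_K: "\<alpha> \<noteq> 0 \<Longrightarrow> fls_subdegree \<alpha> = 0 \<Longrightarrow> diag_mat \<alpha> \<in> K_grp"
  by (simp add: diag_mat_def int_ring_eq_pi_ideal pi_ideal_iff_subdegree)

lemma u_mat_mult: "u_mat x ** u_mat y = u_mat (x + y)"
  by (simp add: u_mat_def)

lemma u_mat_0: "u_mat 0 = mat 1"
  by (simp add: u_mat_def mat_1_eq_mk_mat2)

lemma a_mat_mult: "a_mat m ** a_mat n = a_mat (m + n)"
  by (simp add: a_mat_eq_diag_mat diag_mat_def)

lemma a_mat_0: "a_mat 0 = mat 1"
  by (simp add: a_mat_eq_diag_mat diag_mat_def mat_1_eq_mk_mat2)

text \<open>
  All statements about the vertex \<open>A v\<^sub>0\<close> of the tree are phrased through the coset \<open>A K\<close>.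
\<close>

definition K_coset :: "'q::{field,finite} mat2 \<Rightarrow> 'q mat2 set" where
  "K_coset A = (\<lambda>\<kappa>. A ** \<kappa>) ` K_grp"

lemma K_coset_self: "A \<in> K_coset A"
  unfolding K_coset_def using Kgp.one_closed by (auto intro!: image_eqI[of _ _ "mat 1"])

lemma K_coset_eqI:
  assumes "\<kappa> \<in> K_grp" "A = B ** \<kappa>"
  shows "K_coset A = K_coset B"
proof -
  have "K_coset (B ** \<kappa>) \<subseteq> K_coset B" if "\<kappa> \<in> K_grp" for B \<kappa> :: "'a mat2"
    using Kgp.mult_closed[OF that] by (auto simp: K_coset_def simp flip: matrix_mul_assoc)
  from this[OF assms(1), of B] this[OF Kgp.inv_closed[OF assms(1)], of A] show ?thesis
    using assms by (auto simp: mat2_inv_cancel(4)[OF assms(1)])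
qed

lemma K_coset_eqE:
  assumes "K_coset A = K_coset B"
  obtains \<kappa> where "\<kappa> \<in> K_grp" "A = B ** \<kappa>"
  using assms K_coset_self[of A] by (auto simp: K_coset_def)

lemma K_coset_left: "K_coset A = K_coset B \<Longrightarrow> K_coset (g ** A) = K_coset (g ** B)"
  by (elim K_coset_eqE, rule K_coset_eqI) (auto simp: matrix_mul_assoc)

lemma K_coset_mult_K: "\<kappa> \<in> K_grp \<Longrightarrow> K_coset (A ** \<kappa>) = K_coset A"
  by (rule K_coset_eqI) auto

lemma K_coset_diag_mat:
  assumes "\<alpha> \<noteq> 0"
  shows "K_coset (diag_mat \<alpha>) = K_coset (a_mat (- fls_subdegree \<alpha>))"
proof (rule K_coset_eqI)
  show "diag_mat (\<alpha> * t_pow (fls_subdegree \<alpha>)) \<in> K_grp"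
    using assms by (intro diag_mat_in_K) auto
  show "diag_mat \<alpha> = a_mat (- fls_subdegree \<alpha>) ** diag_mat (\<alpha> * t_pow (fls_subdegree \<alpha>))"
    by (simp add: a_mat_eq_diag_mat diag_mat_def mult.commute[of \<alpha>] mult.assoc[symmetric])
qed

lemma K_coset_u_a:
  assumes "x \<in> pi_ideal (- 2 * j)"
  shows "K_coset (u_mat x ** a_mat j) = K_coset (a_mat j)"
proof (rule K_coset_eqI)
  show "u_mat (t_pow (- 2 * j) * x) \<in> K_grp"
    using assms by (simp add: mult_mem_pi_ideal_iff)
  show "u_mat x ** a_mat j = a_mat j ** u_mat (t_pow (- 2 * j) * x)"
    by (simp add: a_mat_eq_diag_mat mat_defs)
qed

text \<open>
  The vertex on the left is reached from the cusp \<open>0\<close>; rewriting it from the cusp \<open>\<infinity>\<close> uses the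
  Bruhat decomposition \<open>l(y) = u(y\<^sup>-\<^sup>1) diag(y\<^sup>-\<^sup>1, y) w u(y\<^sup>-\<^sup>1)\<close> of a lower unipotent matrix.
  The bound on \<open>y\<close> makes the last factor disappear into \<open>K\<close>.
\<close>

lemma K_coset_l_mat:
  assumes "y \<noteq> 0" "fls_subdegree y \<le> 2 * N"
  shows "K_coset (l_mat y ** a_mat N) = K_coset (u_mat (inverse y) ** a_mat (fls_subdegree y - N))"
proof -
  have "l_mat y ** a_mat N = u_mat (inverse y) ** diag_mat (inverse y) ** weyl ** (u_mat (inverse y) ** a_mat N)"
    using assms(1) by (simp add: a_mat_eq_diag_mat mat_defs algebra_simps)
  also have "K_coset \<dots> = K_coset (u_mat (inverse y) ** diag_mat (inverse y) ** weyl ** a_mat N)"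
    using assms by (intro K_coset_left K_coset_u_a) (simp add: pi_ideal_iff_subdegree)
  also have "u_mat (inverse y) ** diag_mat (inverse y) ** weyl ** a_mat N =
      u_mat (inverse y) ** diag_mat (inverse y * t_pow (- N)) ** weyl"
    by (simp add: a_mat_eq_diag_mat mat_defs)
  also have "K_coset \<dots> = K_coset (u_mat (inverse y) ** a_mat (fls_subdegree y - N))"
    using assms(1) by (subst K_coset_mult_K, simp, intro K_coset_left, subst K_coset_diag_mat) auto
  finally show ?thesis .
qed

definition in_level :: "'q::{field,finite} mat2 \<Rightarrow> nat \<Rightarrow> bool" where
  "in_level g k \<longleftrightarrow> (\<exists>\<gamma>\<in>Gamma_grp. \<exists>\<kappa>\<in>K_grp. g = \<gamma> ** a_mat (int k) ** \<kappa>)"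

definition level :: "'q::{field,finite} mat2 \<Rightarrow> nat" where
  "level g = (THE k. in_level g k)"

lemma in_level_mult_left:
  assumes "\<gamma> \<in> Gamma_grp"
  shows "in_level (\<gamma> ** g) k \<longleftrightarrow> in_level g k"
proof -
  have *: "in_level (\<gamma> ** g) k" if "\<gamma> \<in> Gamma_grp" "in_level g k" for \<gamma> g :: "'a mat2"
    using that Gam.mult_closed[OF that(1)] unfolding in_level_def
    by (force simp: matrix_mul_assoc)
  show ?thesis
    using *[OF assms] *[OF Gam.inv_closed[OF assms], of "\<gamma> ** g"] mat2_inv_cancel(1)[OF assms] by auto
qed

lemma in_level_K_coset:
  assumes "K_coset g = K_coset h"
  shows "in_level g k \<longleftrightarrow> in_level h k"
proof -
  have *: "in_level (g ** \<kappa>) k" if "\<kappa> \<in> K_grp" "in_level g k" for \<kappa> g :: "'a mat2"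
    using that Kgp.mult_closed[OF _ that(1)] unfolding in_level_def
    by (force simp flip: matrix_mul_assoc)
  show ?thesis
    using * K_coset_eqE[OF assms] K_coset_eqE[OF assms[symmetric]] by metis
qed

lemma level_mult_left: "\<gamma> \<in> Gamma_grp \<Longrightarrow> level (\<gamma> ** g) = level g"
  by (simp add: level_def in_level_mult_left)

lemma level_K_coset: "K_coset g = K_coset h \<Longrightarrow> level g = level h"
  using in_level_K_coset[of g h] by (simp add: level_def)

lemma level_mult_K: "\<kappa> \<in> K_grp \<Longrightarrow> level (g ** \<kappa>) = level g"
  by (intro level_K_coset K_coset_mult_K)

lemma lattice_K:
  assumes "\<kappa> \<in> K_grp"
  shows "lattice \<kappa> = std_lattice"
proof -
  have sub: "lattice \<kappa> \<subseteq> std_lattice" if "\<kappa> \<in> K_grp" for \<kappa> :: "'a mat2"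
  proof -
    obtain a b c d where \<kappa>: "\<kappa> = mk_mat2 a b c d" by (rule mat2_exhaust)
    with that have "a \<in> pi_ideal 0" "b \<in> pi_ideal 0" "c \<in> pi_ideal 0" "d \<in> pi_ideal 0"
      by (simp_all add: int_ring_eq_pi_ideal)
    then show ?thesis
      by (auto simp: \<kappa> std_lattice_iff intro!: pi_ideal_add pi_ideal_mult[where m = 0 and n = 0])
  qed
  have "std_lattice = lattice (\<kappa> ** mat2_inv \<kappa>)"
    by (simp add: mat2_inv_right[OF assms])
  also have "\<dots> = (\<lambda>x. \<kappa> *v x) ` lattice (mat2_inv \<kappa>)"
    by (simp add: image_image matrix_vector_mul_assoc)
  also have "\<dots> \<subseteq> lattice \<kappa>"
    by (intro image_mono sub Kgp.inv_closed assms)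
  finally show ?thesis using sub[OF assms] by blast
qed

text \<open>
  The matrix \<open>a\<^sub>k\<close> is \<open>t\<^sup>-\<^sup>k diag(t\<^sup>2\<^sup>k, 1)\<close>, so \<open>a\<^sub>k v\<^sub>0\<close> is the vertex \<open>v\<^sub>2\<^sub>k\<close> of the ray. In
  particular the level is unique.
\<close>

lemma height_in_level:
  assumes "in_level g k"
  shows "height (vertex_act g (ray_vertex 0)) = 2 * k"
proof -
  from assms obtain \<gamma> \<kappa> where \<gamma>: "\<gamma> \<in> Gamma_grp" and \<kappa>: "\<kappa> \<in> K_grp"
    and g: "g = \<gamma> ** a_mat (int k) ** \<kappa>" by (auto simp: in_level_def)
  have "vertex_act g (ray_vertex 0) = homothety_class (lattice (\<gamma> ** a_mat (int k) ** \<kappa>))"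
    by (simp add: vertex_act_ray g flip: mat_1_eq_mk_mat2)
  also have "lattice (\<gamma> ** a_mat (int k) ** \<kappa>) = (\<lambda>x. (\<gamma> ** a_mat (int k)) *v x) ` lattice \<kappa>"
    by (simp add: image_image matrix_vector_mul_assoc)
  also have "\<dots> = (\<lambda>x. \<gamma> *v x) ` (\<lambda>x. a_mat (int k) *v x) ` std_lattice"
    by (simp add: lattice_K[OF \<kappa>] image_image matrix_vector_mul_assoc)
  also have "(\<lambda>x. a_mat (int k) *v x) = (\<lambda>x. t_pow (- int k) *s (ray_mat (2 * k) *v x))"
    by (simp add: fun_eq_iff a_mat_eq_diag_mat diag_mat_def vec_eq_iff forall_2 flip: power_int_of_nat t_pow_def mult.assoc)
  also have "(\<lambda>x. \<gamma> *v x) ` (\<lambda>x. t_pow (- int k) *s (ray_mat (2 * k) *v x)) ` std_lattice =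
      (\<lambda>x. t_pow (- int k) *s x) ` lattice (\<gamma> ** ray_mat (2 * k))"
    by (simp add: image_image matrix_vector_mul_assoc vector_scalar_commute)
  also have "homothety_class \<dots> = vertex_act \<gamma> (ray_vertex (2 * k))"
    by (simp add: homothety_class_scale vertex_act_ray)
  finally show ?thesis
    by (simp add: height_orbit Gamma_subset_GL2 \<gamma>)
qed

lemma level_eqI: "in_level g k \<Longrightarrow> level g = k"
  unfolding level_def
proof (rule the_equality)
  fix l assume "in_level g k" "in_level g l"
  then show "l = k" using height_in_level[of g k] height_in_level[of g l] by simp
qed

lemma in_level_a_mat: "in_level (a_mat (int k)) k"
  unfolding in_level_def using Gam.one_closed Kgp.one_closed
  by (intro bexI[of _ "mat 1"]) auto

lemma in_level_a_mat_uminus: "in_level (a_mat (- int k)) k"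
proof -
  have "in_level (weyl ** a_mat (int k)) k"
    by (simp add: in_level_mult_left in_level_a_mat)
  also have "weyl ** a_mat (int k) = a_mat (- int k) ** weyl"
    by (simp add: a_mat_eq_diag_mat mat_defs)
  finally show ?thesis
    by (simp add: in_level_K_coset[OF K_coset_mult_K, of weyl])
qed

lemma in_level_u_a_nonneg: "in_level (u_mat x ** a_mat (int k)) k"
proof -
  obtain p r where pr: "p \<in> poly_ring" "r \<in> pi_ideal 1" "x = p + r"
    by (rule poly_plus_pi_ideal)
  have *: "K_coset (u_mat r ** a_mat (int k)) = K_coset (a_mat (int k))"
    using pr(2) by (intro K_coset_u_a) (auto elim: pi_ideal_mono)
  then have "in_level (u_mat p ** (u_mat r ** a_mat (int k))) k"
    using pr(1) by (simp add: in_level_mult_left in_level_K_coset[OF *] in_level_a_mat)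
  then show ?thesis by (simp add: pr(3) matrix_mul_assoc u_mat_mult)
qed

text \<open>
  One step of the continued fraction algorithm for \<open>x\<close>: the Weyl element, which lies in \<open>\<Gamma>\<close>,
  replaces \<open>x\<close> by \<open>- x\<^sup>-\<^sup>1\<close> and raises the index \<open>- N\<close> by the valuation of \<open>x\<close>.
\<close>

lemma in_level_u_a_turn:
  assumes "x \<noteq> 0" "fls_subdegree x \<le> 2 * N"
  shows "in_level (u_mat x ** a_mat (- N)) k \<longleftrightarrow>
    in_level (u_mat (inverse (- x)) ** a_mat (fls_subdegree x - N)) k"
proof -
  have "in_level (u_mat x ** a_mat (- N)) k \<longleftrightarrow> in_level (weyl ** (u_mat x ** a_mat (- N))) k"
    by (simp add: in_level_mult_left)
  also have "weyl ** (u_mat x ** a_mat (- N)) = l_mat (- x) ** a_mat N ** weyl"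
    by (simp add: a_mat_eq_diag_mat mat_defs)
  also have "in_level \<dots> k \<longleftrightarrow> in_level (l_mat (- x) ** a_mat N) k"
    by (intro in_level_K_coset K_coset_mult_K) simp
  also have "\<dots> \<longleftrightarrow> in_level (u_mat (inverse (- x)) ** a_mat (fls_subdegree x - N)) k"
    using K_coset_l_mat[of "- x" N] assms by (intro in_level_K_coset) simp
  finally show ?thesis .
qed

text \<open>
  Subtracting the integral part of \<open>x\<close> and inverting strictly increases a negative \<open>j\<close>, because the
  fractional part has positive valuation. The algorithm stops when the fractional part is negligible
  or \<open>j\<close> is nonnegative.
\<close>

lemma ex_in_level_u_a: "\<exists>k. in_level (u_mat x ** a_mat j) k"
proof (induction "nat (- j)" arbitrary: x j rule: less_induct)
  case less
  show ?case
  proof (cases "j \<ge> 0")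
    case True
    then show ?thesis using in_level_u_a_nonneg[of x "nat j"] by auto
  next
    case False
    obtain p r where pr: "p \<in> poly_ring" "r \<in> pi_ideal 1" "x = p + r"
      by (rule poly_plus_pi_ideal)
    have p: "in_level (u_mat x ** a_mat j) k \<longleftrightarrow> in_level (u_mat r ** a_mat j) k" for k
      using pr(1) in_level_mult_left[of "u_mat p" "u_mat r ** a_mat j"]
      by (simp add: pr(3) matrix_mul_assoc u_mat_mult)
    show ?thesis
    proof (cases "r \<in> pi_ideal (- 2 * j)")
      case True
      then show ?thesis
        using in_level_K_coset[OF K_coset_u_a[OF True]] in_level_a_mat_uminus[of "nat (- j)"] False p
        by auto
    next
      case r: False
      then have nz: "r \<noteq> 0" "fls_subdegree r \<le> 2 * (- j)"
        by (auto simp: pi_ideal_iff_subdegree)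
      from pr(2) nz(1) have "fls_subdegree r \<ge> 1" by (simp add: pi_ideal_iff_subdegree)
      then have "nat (- (fls_subdegree r - (- j))) < nat (- j)" using False by auto
      from less[OF this, of "inverse (- r)"] obtain k
        where "in_level (u_mat (inverse (- r)) ** a_mat (fls_subdegree r - - j)) k" by auto
      then have "in_level (u_mat x ** a_mat j) k"
        using in_level_u_a_turn[OF nz, of k] p[of k] by simp
      then show ?thesis ..
    qed
  qed
qed

text \<open>
  Column operations by \<open>K\<close> clear the lower left entry: the lower right entry divides it in \<open>\<O>\<close>,
  possibly after exchanging the two columns.
\<close>

lemma iwasawa:
  assumes "g \<in> G_grp"
  obtains (decomp) x \<alpha> \<kappa> where "\<alpha> \<noteq> 0" "\<kappa> \<in> K_grp" "g = u_mat x ** diag_mat \<alpha> ** \<kappa>"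
proof -
  have upper: thesis if "mk_mat2 \<alpha> \<beta> 0 d = g ** \<kappa>'" "\<kappa>' \<in> K_grp" for \<alpha> \<beta> d \<kappa>'
  proof -
    have "mk_mat2 \<alpha> \<beta> 0 d \<in> G_grp"
      unfolding that(1) by (rule Ggp.mult_closed[OF assms SL2_in_G[OF that(2)]])
    then have "\<alpha> * d = 1" by simp
    then have d: "\<alpha> \<noteq> 0" "d = inverse \<alpha>"
      by (auto dest: inverse_unique)
    have "g = mk_mat2 \<alpha> \<beta> 0 d ** mat2_inv \<kappa>'"
      by (simp add: that mat2_inv_cancel(4)[OF that(2)])
    also have "mk_mat2 \<alpha> \<beta> 0 d = u_mat (\<alpha> * \<beta>) ** diag_mat \<alpha>"
      using d by (simp add: mat_defs)
    finally show thesis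
      by (rule decomp[OF d(1) Kgp.inv_closed[OF that(2)]])
  qed
  obtain a b c d where g: "g = mk_mat2 a b c d" by (rule mat2_exhaust)
  have "a * d - b * c = 1" using assms by (simp add: g)
  then have cd: "c \<noteq> 0 \<or> d \<noteq> 0" by auto
  show thesis
  proof (cases "d = 0 \<or> (c \<noteq> 0 \<and> fls_subdegree c < fls_subdegree d)")
    case True
    with cd have "c \<noteq> 0" by auto
    show thesis
    proof (rule upper)
      show "mk_mat2 (a * (- d / c) + b) (- a) 0 (- c) = g ** (weyl ** l_mat (d / c))"
        using \<open>c \<noteq> 0\<close> by (simp add: g mat_defs)
      have "d / c \<in> pi_ideal 0"
        using True \<open>c \<noteq> 0\<close> by (cases "d = 0") (auto simp: pi_ideal_iff_subdegree fls_divide_subdegree)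
      then show "weyl ** l_mat (d / c) \<in> K_grp"
        by (intro Kgp.mult_closed) auto
    qed
  next
    case False
    show thesis
    proof (rule upper)
      show "mk_mat2 (a + b * (- c / d)) b 0 d = g ** l_mat (- c / d)"
        using False by (simp add: g mat_defs)
      show "l_mat (- c / d) \<in> K_grp"
        using False by (cases "c = 0") (auto simp: pi_ideal_iff_subdegree fls_divide_subdegree)
    qed
  qed
qed

lemma in_level_level:
  assumes "g \<in> G_grp"
  shows "in_level g (level g)"
proof -
  obtain x \<alpha> \<kappa> where *: "\<alpha> \<noteq> 0" "\<kappa> \<in> K_grp" "g = u_mat x ** diag_mat \<alpha> ** \<kappa>"
    using iwasawa[OF assms] .
  have "K_coset g = K_coset (u_mat x ** a_mat (- fls_subdegree \<alpha>))"
    unfolding *(3) K_coset_mult_K[OF *(2)] by (rule K_coset_left[OF K_coset_diag_mat[OF *(1)]])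
  moreover obtain k where "in_level (u_mat x ** a_mat (- fls_subdegree \<alpha>)) k"
    using ex_in_level_u_a by blast
  ultimately have "in_level g k" using in_level_K_coset by blast
  with level_eqI[OF this] show ?thesis by simp
qed

lemma level_decomp:
  assumes "g \<in> G_grp"
  obtains \<gamma> \<kappa> where "\<gamma> \<in> Gamma_grp" "\<kappa> \<in> K_grp" "g = \<gamma> ** a_mat (int (level g)) ** \<kappa>"
  using in_level_level[OF assms] by (auto simp: in_level_def)

lemma level_a_mat: "level (a_mat j) = nat \<bar>j\<bar>"
  using level_eqI[OF in_level_a_mat[of "nat j"]] level_eqI[OF in_level_a_mat_uminus[of "nat (- j)"]]
  by (cases "j \<ge> 0") auto

lemma level_u_a_nonneg: "j \<ge> 0 \<Longrightarrow> level (u_mat x ** a_mat j) = nat j"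
  using level_eqI[OF in_level_u_a_nonneg[of x "nat j"]] by simp

lemma level_u_a_turn:
  "x \<noteq> 0 \<Longrightarrow> fls_subdegree x \<le> 2 * N \<Longrightarrow>
    level (u_mat x ** a_mat (- N)) = level (u_mat (inverse (- x)) ** a_mat (fls_subdegree x - N))"
  by (simp add: level_def in_level_u_a_turn)

section \<open>The Hecke operator of \<open>K a\<^sub>1 K\<close> on levels\<close>

lemma K_coset_eq_imp_in_K:
  assumes "K_coset A = K_coset B" "B \<in> G_grp"
  shows "mat2_inv B ** A \<in> K_grp"
  using assms by (auto elim!: K_coset_eqE simp: mat2_inv_cancel(1))

text \<open>
  Representatives of the left cosets of \<open>K\<close> in \<open>K a\<^sub>1 K\<close>, indexed by the projective line over
  \<open>\<O>/\<pi>\<^sup>2\<O>\<close>: its \<open>q\<^sup>2\<close> points \<open>[s : 1]\<close> and its \<open>q\<close> points \<open>[1 : s]\<close> with \<open>s\<close> divisible by \<open>\<pi>\<close>.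
\<close>

fun hecke_rep :: "('q \<times> 'q) + 'q \<Rightarrow> 'q::{field,finite} mat2" where
  "hecke_rep (Inl (a, b)) = u_mat (fls_const a + fls_const b * t_pow (-1)) ** a_mat (-1)"
| "hecke_rep (Inr b) = l_mat (fls_const b * t_pow (-1)) ** a_mat 1"

lemma hecke_rep_in_G [simp]: "hecke_rep i \<in> G_grp"
  by (cases i rule: hecke_rep.cases) (auto intro!: Ggp.mult_closed)

lemma t_pow_nth: "fls_nth (t_pow n) k = (if k = - n then 1 else 0)"
  by (simp add: t_pow_def X_inv_powi_nth)

lemma digit_in_pi_ideal: "fls_const b * t_pow (-1) \<in> pi_ideal 1" "fls_const a + fls_const b * t_pow (-1) \<in> pi_ideal 0"
  by (auto simp: pi_ideal_def t_pow_nth)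

lemma digit_expansion:
  assumes "x \<in> pi_ideal 0"
  shows "x - (fls_const (fls_nth x 0) + fls_const (fls_nth x 1) * t_pow (-1)) \<in> pi_ideal 2"
proof -
  have "fls_nth x i = 0 \<or> i = 0 \<or> i = 1" if "i < 2" for i
    using assms that by (cases "i < 0") (auto simp: pi_ideal_def)
  then show ?thesis
    by (auto simp: pi_ideal_def t_pow_nth)
qed

lemma K_coset_l_mat_a_cong:
  assumes "x - y \<in> pi_ideal 2"
  shows "K_coset (l_mat x ** a_mat 1) = K_coset (l_mat y ** a_mat 1)"
proof (rule K_coset_eqI)
  show "l_mat (t_pow 2 * (x - y)) \<in> K_grp"
    using assms by (simp add: mult_mem_pi_ideal_iff)
  show "l_mat x ** a_mat 1 = l_mat y ** a_mat 1 ** l_mat (t_pow 2 * (x - y))"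
    by (simp add: a_mat_eq_diag_mat mat_defs) (simp add: algebra_simps)
qed

lemma K_coset_u_a_cong:
  assumes "x - y \<in> pi_ideal 2"
  shows "K_coset (u_mat x ** a_mat (-1)) = K_coset (u_mat y ** a_mat (-1))"
proof -
  have "K_coset (u_mat y ** (u_mat (x - y) ** a_mat (-1))) = K_coset (u_mat y ** a_mat (-1))"
    using assms by (intro K_coset_left K_coset_u_a) simp
  then show ?thesis by (simp add: matrix_mul_assoc u_mat_mult)
qed

text \<open>
  Only the first column \<open>(a, c)\<close> of \<open>\<kappa>\<close> matters, up to scaling and modulo \<open>\<pi>\<^sup>2\<close>, and at least one of
  its entries is a unit.
\<close>

lemma hecke_rep_covers:
  fixes \<kappa> :: "'q::{field,finite} mat2"
  assumes "\<kappa> \<in> K_grp"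
  obtains i where "K_coset (\<kappa> ** a_mat 1) = K_coset (hecke_rep i)"
proof -
  obtain a b c d where \<kappa>: "\<kappa> = mk_mat2 a b c d" by (rule mat2_exhaust)
  with assms have in0: "a \<in> pi_ideal 0" "b \<in> pi_ideal 0" "c \<in> pi_ideal 0" "d \<in> pi_ideal 0"
    and det: "a * d - b * c = 1" by (simp_all add: int_ring_eq_pi_ideal)
  show thesis
  proof (cases "c \<in> pi_ideal 1")
    case True
    have unit: "a \<noteq> 0" "fls_subdegree a = 0"
    proof -
      have "a \<notin> pi_ideal 1"
      proof
        assume "a \<in> pi_ideal 1"
        then have "a * d - b * c \<in> pi_ideal 1"
          using in0 True by (intro pi_ideal_diff) (rule pi_ideal_mult, assumption+, simp)+
        then show False by (simp add: det pi_ideal_iff_subdegree)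
      qed
      then show "a \<noteq> 0" "fls_subdegree a = 0"
        using in0(1) by (auto simp: pi_ideal_iff_subdegree)
    qed
    have ca: "c / a \<in> pi_ideal 1"
      using True unit by (cases "c = 0") (auto simp: pi_ideal_iff_subdegree fls_divide_subdegree)
    have "K_coset (\<kappa> ** a_mat 1) = K_coset (l_mat (c / a) ** a_mat 1)"
    proof (rule K_coset_eqI)
      show "mk_mat2 a (t_pow (-2) * b) 0 (inverse a) \<in> K_grp"
        using in0 unit
        by (auto simp: int_ring_eq_pi_ideal mult_mem_pi_ideal_iff pi_ideal_inverse elim: pi_ideal_mono)
      define e where "e = c / a"
      have c: "c = e * a" and d: "d = e * b + inverse a"
        using unit(1) det by (simp_all add: e_def field_simps)
      have "\<kappa> ** a_mat 1 = l_mat e ** a_mat 1 ** mk_mat2 a (t_pow (-2) * b) 0 (inverse a)"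
        unfolding \<kappa> c d by (simp add: a_mat_eq_diag_mat mat_defs) (simp add: algebra_simps)
      then show "\<kappa> ** a_mat 1 = l_mat (c / a) ** a_mat 1 ** mk_mat2 a (t_pow (-2) * b) 0 (inverse a)"
        by (simp only: e_def)
    qed
    also have "\<dots> = K_coset (l_mat (fls_const (fls_nth (c / a) 1) * t_pow (-1)) ** a_mat 1)"
    proof (rule K_coset_l_mat_a_cong)
      have "fls_nth (c / a) 0 = 0" using ca by (simp add: pi_ideal_def)
      with digit_expansion[OF pi_ideal_mono[OF ca]]
      show "c / a - fls_const (fls_nth (c / a) 1) * t_pow (-1) \<in> pi_ideal 2" by simp
    qed
    finally show thesis
      using that[of "Inr (fls_nth (c / a) 1)"] by simp
  next
    case False
    then have unit: "c \<noteq> 0" "fls_subdegree c = 0"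
      using in0(3) by (auto simp: pi_ideal_iff_subdegree)
    have "K_coset (\<kappa> ** a_mat 1) = K_coset (u_mat (a / c) ** a_mat (-1))"
    proof (rule K_coset_eqI)
      show "mk_mat2 0 (- inverse c) c (t_pow (-2) * d) \<in> K_grp"
        using in0 unit
        by (auto simp: int_ring_eq_pi_ideal mult_mem_pi_ideal_iff pi_ideal_inverse elim: pi_ideal_mono)
      define e where "e = a / c"
      have a: "a = e * c" and b: "b = e * d - inverse c"
        using unit(1) det by (simp_all add: e_def field_simps)
      have "\<kappa> ** a_mat 1 = u_mat e ** a_mat (-1) ** mk_mat2 0 (- inverse c) c (t_pow (-2) * d)"
        unfolding \<kappa> a b by (simp add: a_mat_eq_diag_mat mat_defs) (simp add: algebra_simps)
      then show "\<kappa> ** a_mat 1 = u_mat (a / c) ** a_mat (-1) ** mk_mat2 0 (- inverse c) c (t_pow (-2) * d)"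
        by (simp only: e_def)
    qed
    also have "\<dots> = K_coset (hecke_rep (Inl (fls_nth (a / c) 0, fls_nth (a / c) 1)))"
    proof -
      have "a / c \<in> pi_ideal 0"
        using in0(1) unit by (cases "a = 0") (auto simp: pi_ideal_iff_subdegree fls_divide_subdegree)
      then show ?thesis
        unfolding hecke_rep.simps by (intro K_coset_u_a_cong digit_expansion)
    qed
    finally show thesis by (rule that)
  qed
qed

lemma K_coset_a_minus: "K_coset (a_mat (-1)) = K_coset (weyl ** a_mat 1)"
proof -
  have "weyl ** a_mat 1 = a_mat (-1) ** weyl"
    by (simp add: a_mat_eq_diag_mat mat_defs)
  then show ?thesis by (metis K_coset_mult_K elementary_mats_in_SL2(7))
qed

lemma hecke_rep_in_double_coset:
  obtains \<kappa> where "\<kappa> \<in> K_grp" "K_coset (hecke_rep i) = K_coset (\<kappa> ** a_mat 1)"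
proof (cases i rule: hecke_rep.cases)
  case (1 a b)
  show thesis
  proof (rule that)
    show "u_mat (fls_const a + fls_const b * t_pow (-1)) ** weyl \<in> K_grp"
      by (intro Kgp.mult_closed) (simp_all add: digit_in_pi_ideal)
    show "K_coset (hecke_rep i) = K_coset (u_mat (fls_const a + fls_const b * t_pow (-1)) ** weyl ** a_mat 1)"
      unfolding 1 hecke_rep.simps matrix_mul_assoc[symmetric] by (rule K_coset_left[OF K_coset_a_minus])
  qed
next
  case (2 b)
  show thesis
    by (rule that[of "l_mat (fls_const b * t_pow (-1))"])
      (use pi_ideal_mono[OF digit_in_pi_ideal(1), of 0] in \<open>simp_all add: 2\<close>)
qed

lemma hecke_rep_inj:
  fixes i j :: "('q \<times> 'q) + 'q::{field,finite}"
  assumes "K_coset (hecke_rep i) = K_coset (hecke_rep j)"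
  shows "i = j"
proof -
  \<comment> \<open>The upper left entry of the quotient is \<open>t\<^sup>2\<close> times a unit, hence not in \<open>\<O>\<close>.\<close>
  have cross: "K_coset (hecke_rep (Inr c)) \<noteq> K_coset (hecke_rep (Inl (a, b)))" for a b c :: 'q
  proof
    assume "K_coset (hecke_rep (Inr c)) = K_coset (hecke_rep (Inl (a, b)))"
    from K_coset_eq_imp_in_K[OF this hecke_rep_in_G]
    have "mat2_inv (hecke_rep (Inl (a, b))) ** hecke_rep (Inr c) \<in> K_grp" .
    then have "t_pow 2 * (1 - (fls_const a + fls_const b * t_pow (-1)) * (fls_const c * t_pow (-1))) \<in> pi_ideal 0"
      by (simp add: a_mat_eq_diag_mat mat_defs int_ring_eq_pi_ideal) (simp add: algebra_simps)
    then have "1 - (fls_const a + fls_const b * t_pow (-1)) * (fls_const c * t_pow (-1)) \<in> pi_ideal 1"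
      by (auto simp: mult_mem_pi_ideal_iff elim: pi_ideal_mono)
    moreover have "(fls_const a + fls_const b * t_pow (-1)) * (fls_const c * t_pow (-1)) \<in> pi_ideal 1"
      by (rule pi_ideal_mult[OF digit_in_pi_ideal(2,1)]) simp
    ultimately have "(1 :: 'q fls) \<in> pi_ideal 1"
      by (metis diff_add_cancel pi_ideal_add)
    then show False by (simp add: pi_ideal_iff_subdegree)
  qed
  show ?thesis
  proof (cases i rule: hecke_rep.cases)
    case i: (1 a b)
    show ?thesis
    proof (cases j rule: hecke_rep.cases)
      case j: (1 a' b')
      define x where "x = fls_const a + fls_const b * t_pow (-1) - (fls_const a' + fls_const b' * t_pow (-1))"
      from K_coset_eq_imp_in_K[OF assms hecke_rep_in_G]
      have "t_pow 2 * x \<in> pi_ideal 0"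
        by (simp add: i j a_mat_eq_diag_mat mat_defs int_ring_eq_pi_ideal x_def) (simp add: algebra_simps)
      then have "x \<in> pi_ideal 2" by (simp add: mult_mem_pi_ideal_iff)
      then have "fls_nth x 0 = 0" "fls_nth x 1 = 0" by (auto simp: pi_ideal_def)
      then show ?thesis by (simp add: i j x_def t_pow_nth)
    next
      case (2 c)
      with i assms cross[of c a b] show ?thesis by simp
    qed
  next
    case i: (2 b)
    show ?thesis
    proof (cases j rule: hecke_rep.cases)
      case (1 a' b')
      with i assms cross[of b a' b'] show ?thesis by simp
    next
      case j: (2 b')
      define x where "x = fls_const b * t_pow (-1) - fls_const b' * t_pow (-1)"
      from K_coset_eq_imp_in_K[OF assms hecke_rep_in_G]
      have "t_pow 2 * x \<in> pi_ideal 0"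
        by (simp add: i j a_mat_eq_diag_mat mat_defs int_ring_eq_pi_ideal x_def) (simp add: algebra_simps)
      then have "x \<in> pi_ideal 2" by (simp add: mult_mem_pi_ideal_iff)
      then have "fls_nth x 1 = 0" by (auto simp: pi_ideal_def)
      then show ?thesis by (simp add: i j x_def t_pow_nth)
    qed
  qed
qed

text \<open>
  Left multiplication by \<open>K\<close> acts on the cosets in \<open>K a\<^sub>1 K\<close>, hence permutes the representatives
  up to \<open>K\<close>. This is what makes sums over Hecke neighbours functions on \<open>\<Gamma>\G/K\<close>.
\<close>

lemma hecke_rep_permuted:
  fixes \<kappa> :: "'q::{field,finite} mat2"
  assumes "\<kappa> \<in> K_grp"
  obtains \<sigma> where "bij \<sigma>" "\<And>i. K_coset (\<kappa> ** hecke_rep i) = K_coset (hecke_rep (\<sigma> i))"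
proof -
  have "\<exists>j. K_coset (\<kappa> ** hecke_rep i) = K_coset (hecke_rep j)" for i
  proof -
    obtain \<kappa>' where \<kappa>': "\<kappa>' \<in> K_grp" "K_coset (hecke_rep i) = K_coset (\<kappa>' ** a_mat 1)"
      by (rule hecke_rep_in_double_coset)
    have "K_coset (\<kappa> ** hecke_rep i) = K_coset (\<kappa> ** \<kappa>' ** a_mat 1)"
      using K_coset_left[OF \<kappa>'(2), of \<kappa>] by (simp add: matrix_mul_assoc)
    with hecke_rep_covers[OF Kgp.mult_closed[OF assms \<kappa>'(1)]] show ?thesis by metis
  qed
  then obtain \<sigma> where \<sigma>: "\<And>i. K_coset (\<kappa> ** hecke_rep i) = K_coset (hecke_rep (\<sigma> i))"
    by metis
  have "inj \<sigma>"
  proof (rule injI)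
    fix i j assume "\<sigma> i = \<sigma> j"
    then have "K_coset (\<kappa> ** hecke_rep i) = K_coset (\<kappa> ** hecke_rep j)" by (simp add: \<sigma>)
    from K_coset_left[OF this, of "mat2_inv \<kappa>"] show "i = j"
      by (intro hecke_rep_inj) (simp add: mat2_inv_cancel(1)[OF assms])
  qed
  then have "bij \<sigma>" by (simp add: bij_def finite_UNIV_inj_surj)
  then show thesis using \<sigma> by (rule that)
qed

lemma sum_hecke_index:
  "(\<Sum>i\<in>UNIV. F i) = (\<Sum>p\<in>UNIV. F (Inl p)) + (\<Sum>b\<in>UNIV. F (Inr b))"
  for F :: "('q \<times> 'q) + 'q::finite \<Rightarrow> real"
  unfolding UNIV_Plus_UNIV[symmetric] by (subst sum.Plus) (auto simp: comp_def)

lemma K_coset_hecke_rep_Inr: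
  assumes "b \<noteq> 0"
  shows "K_coset (hecke_rep (Inr b)) = K_coset (u_mat (inverse (fls_const b * t_pow (-1))))"
  using K_coset_l_mat[of "fls_const b * t_pow (-1)" 1] assms by (simp add: a_mat_0 del: inverse_mult_distrib)

lemma a_u_commute: "a_mat n ** u_mat x = u_mat (t_pow (2 * n) * x) ** a_mat n"
  by (simp add: a_mat_eq_diag_mat mat_defs mult.commute[of x] mult.assoc[symmetric])

lemma hecke_rep_Inr_0: "hecke_rep (Inr 0) = a_mat 1"
  by (simp add: l_mat_def flip: mat_1_eq_mk_mat2)

lemma level_hecke_up:
  "level (a_mat (int k) ** hecke_rep (Inr b)) = (if b = 0 then k + 1 else k)"
proof (cases "b = 0")
  case True
  then show ?thesis by (simp only: hecke_rep_Inr_0) (simp add: a_mat_mult level_a_mat)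
next
  case False
  have "level (a_mat (int k) ** hecke_rep (Inr b)) =
      level (a_mat (int k) ** u_mat (inverse (fls_const b * t_pow (-1))))"
    by (rule level_K_coset[OF K_coset_left[OF K_coset_hecke_rep_Inr[OF False]]])
  also have "\<dots> = k"
    unfolding a_u_commute by (simp add: level_u_a_nonneg)
  finally show ?thesis using False by simp
qed

text \<open>
  For \<open>k > 0\<close> the translation by \<open>t\<^sup>2\<^sup>k s\<close> does not change the level, since the matrix \<open>a\<^bsub>k-1\<^esub>\<close>
  behind it has nonnegative index. For \<open>k = 0\<close> the constant part of \<open>s\<close> lies in \<open>\<Gamma>\<close>, and the rest
  needs one turn at the cusp unless it vanishes.
\<close>

lemma level_hecke_down:
  "level (a_mat (int k) ** hecke_rep (Inl (a, b))) = (if k > 0 then k - 1 else if b = 0 then 1 else 0)"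
proof -
  have *: "level (a_mat (int k) ** hecke_rep (Inl (a, b))) =
      level (u_mat (t_pow (2 * int k) * (fls_const a + fls_const b * t_pow (-1))) ** a_mat (int k - 1))"
    by (simp add: matrix_mul_assoc a_u_commute) (simp add: a_mat_mult flip: matrix_mul_assoc)
  show ?thesis
  proof (cases "k > 0")
    case True
    then show ?thesis unfolding * by (subst level_u_a_nonneg) auto
  next
    case False
    have "level (u_mat (fls_const a + fls_const b * t_pow (-1)) ** a_mat (-1)) =
        level (u_mat (fls_const a) ** (u_mat (fls_const b * t_pow (-1)) ** a_mat (-1)))"
      by (simp add: matrix_mul_assoc u_mat_mult)
    also have "\<dots> = level (u_mat (fls_const b * t_pow (-1)) ** a_mat (-1))"
      by (rule level_mult_left) simp
    also have "\<dots> = (if b = 0 then 1 else 0)"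
    proof (cases "b = 0")
      case True
      then show ?thesis by (simp add: u_mat_0 level_a_mat)
    next
      case False
      with level_u_a_turn[of "fls_const b * t_pow (-1)" 1] show ?thesis
        by (simp add: level_u_a_nonneg)
    qed
    finally show ?thesis using False unfolding * by simp
  qed
qed

text \<open>
  Writing \<open>g = \<gamma> a\<^sub>k \<kappa>\<close>, the factor \<open>\<kappa>\<close> only permutes the summands and \<open>\<gamma>\<close> does not change
  levels, so it suffices to count for \<open>g = a\<^sub>k\<close>.
\<close>

lemma hecke_level_sum:
  fixes g :: "'q::{field,finite} mat2" and \<phi> :: "nat \<Rightarrow> real"
  assumes "g \<in> G_grp"
  defines "q \<equiv> real CARD('q)"
  shows "(\<Sum>i\<in>UNIV. \<phi> (level (g ** hecke_rep i))) =
    (if level g = 0 then (q + 1) * \<phi> 1 + (q\<^sup>2 - 1) * \<phi> 0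
     else \<phi> (level g + 1) + (q - 1) * \<phi> (level g) + q\<^sup>2 * \<phi> (level g - 1))"
proof -
  obtain \<gamma> \<kappa> where \<gamma>: "\<gamma> \<in> Gamma_grp" and \<kappa>: "\<kappa> \<in> K_grp"
    and g: "g = \<gamma> ** a_mat (int (level g)) ** \<kappa>"
    using level_decomp[OF assms(1)] .
  obtain \<sigma> where \<sigma>: "bij \<sigma>" "\<And>i. K_coset (\<kappa> ** hecke_rep i) = K_coset (hecke_rep (\<sigma> i))"
    using hecke_rep_permuted[OF \<kappa>] by metis
  define k where "k = level g"
  have lv: "level (g ** hecke_rep i) = level (a_mat (int k) ** hecke_rep (\<sigma> i))" for i
  proof -
    have "level (g ** hecke_rep i) = level (\<gamma> ** (a_mat (int k) ** (\<kappa> ** hecke_rep i)))"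
      by (subst g) (simp add: k_def matrix_mul_assoc)
    also have "\<dots> = level (a_mat (int k) ** (\<kappa> ** hecke_rep i))"
      by (rule level_mult_left[OF \<gamma>])
    also have "\<dots> = level (a_mat (int k) ** hecke_rep (\<sigma> i))"
      by (rule level_K_coset[OF K_coset_left[OF \<sigma>(2)]])
    finally show ?thesis .
  qed
  have "(\<Sum>i\<in>UNIV. \<phi> (level (g ** hecke_rep i))) = (\<Sum>i\<in>UNIV. \<phi> (level (a_mat (int k) ** hecke_rep (\<sigma> i))))"
    by (simp add: lv)
  also have "\<dots> = (\<Sum>i\<in>UNIV. \<phi> (level (a_mat (int k) ** (hecke_rep i :: 'q mat2))))"
    by (rule sum.reindex_bij_betw[OF \<sigma>(1)])
  also have "\<dots> = (\<Sum>(a :: 'q, b)\<in>UNIV. \<phi> (if k > 0 then k - 1 else if (b :: 'q) = 0 then 1 else 0))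
      + (\<Sum>b\<in>UNIV. \<phi> (if (b :: 'q) = 0 then k + 1 else k))"
    unfolding sum_hecke_index
    by (intro arg_cong2[where f = "(+)"] sum.cong refl)
      (auto simp: level_hecke_down level_hecke_up simp del: hecke_rep.simps)
  also have "(\<Sum>b\<in>UNIV. \<phi> (if (b :: 'q) = 0 then k + 1 else k)) = \<phi> (k + 1) + (q - 1) * \<phi> k"
    by (subst sum.remove[of _ 0]) (auto simp: q_def card_Diff_singleton of_nat_diff Suc_le_eq)
  also have "(\<Sum>(a :: 'q, b)\<in>UNIV. \<phi> (if k > 0 then k - 1 else if (b :: 'q) = 0 then 1 else 0)) =
      q * (\<Sum>b\<in>UNIV. \<phi> (if k > 0 then k - 1 else if (b :: 'q) = 0 then 1 else 0))"
    unfolding UNIV_Times_UNIV[symmetric] by (subst sum.cartesian_product[symmetric]) (simp add: q_def)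
  also have "(\<Sum>b\<in>UNIV. \<phi> (if k > 0 then k - 1 else if (b :: 'q) = 0 then 1 else 0)) =
      (if k > 0 then q * \<phi> (k - 1) else \<phi> 1 + (q - 1) * \<phi> 0)"
    by (subst sum.remove[of _ 0]) (auto simp: q_def card_Diff_singleton of_nat_diff Suc_le_eq algebra_simps)
  finally show ?thesis
    by (auto simp: k_def algebra_simps power2_eq_square)
qed


section \<open>Levels of points of \<open>X\<close>\<close>

lemma Gamma_coset_self: "g \<in> Gamma_coset g"
  unfolding Gamma_coset_def using Gam.one_closed by (auto intro!: image_eqI[of _ _ "mat 1"])

lemma Gamma_coset_mult_left:
  assumes "\<gamma> \<in> Gamma_grp"
  shows "Gamma_coset (\<gamma> ** g) = Gamma_coset g"
proof -
  have sub: "Gamma_coset (\<gamma> ** g) \<subseteq> Gamma_coset g" if "\<gamma> \<in> Gamma_grp" for \<gamma> g :: "'a mat2"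
    using Gam.mult_closed[OF _ that] by (auto simp: Gamma_coset_def matrix_mul_assoc)
  from sub[OF assms, of g] sub[OF Gam.inv_closed[OF assms], of "\<gamma> ** g"] show ?thesis
    by (simp add: mat2_inv_cancel(1)[OF assms])
qed

lemma Gamma_coset_eqD:
  assumes "Gamma_coset g = Gamma_coset h"
  obtains \<gamma> where "\<gamma> \<in> Gamma_grp" "g = \<gamma> ** h"
  using assms Gamma_coset_self[of g] by (auto simp: Gamma_coset_def)

lemma right_act_Gamma_coset: "right_act (Gamma_coset g) h = Gamma_coset (g ** h)"
  by (simp add: right_act_def Gamma_coset_def image_image matrix_mul_assoc)

lemma right_act_right_act: "right_act (right_act x g) h = right_act x (g ** h)"
  by (simp add: right_act_def image_image matrix_mul_assoc)

lemma right_act_mat_1 [simp]: "right_act x (mat 1) = x"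
  by (simp add: right_act_def)

lemma right_act_in_X: "x \<in> X_space \<Longrightarrow> g \<in> G_grp \<Longrightarrow> right_act x g \<in> X_space"
  by (auto simp: X_space_def right_act_Gamma_coset intro!: imageI Ggp.mult_closed)

lemma height_K_Gamma_coset:
  assumes "g \<in> G_grp"
  shows "height_K (Gamma_coset g) = 2 * level g"
proof -
  have "height (vertex_act h (ray_vertex 0)) = 2 * level g" if "h \<in> Gamma_coset g" for h
    using that in_level_level[OF assms]
    by (auto simp: Gamma_coset_def in_level_mult_left intro!: height_in_level)
  then show ?thesis
    unfolding height_K_def using Gamma_coset_self[of g] by (intro the_equality) auto
qed

text \<open>
  Points of \<open>X\<close> have even height: the height of \<open>g v\<^sub>0\<close> has the parity of the valuation of \<open>det g\<close>.
\<close>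

definition coset_level :: "'q::{field,finite} coset \<Rightarrow> nat" where
  "coset_level x = height_K x div 2"

lemma coset_level_Gamma_coset: "g \<in> G_grp \<Longrightarrow> coset_level (Gamma_coset g) = level g"
  by (simp add: coset_level_def height_K_Gamma_coset)

lemma height_K_eq_coset_level: "x \<in> X_space \<Longrightarrow> height_K x = 2 * coset_level x"
  by (auto simp: X_space_def coset_level_Gamma_coset height_K_Gamma_coset)

lemma coset_level_right_act_K_coset:
  assumes "x \<in> X_space" "A \<in> G_grp" "B \<in> G_grp" "K_coset A = K_coset B"
  shows "coset_level (right_act x A) = coset_level (right_act x B)"
  using assms by (auto simp: X_space_def right_act_Gamma_coset coset_level_Gamma_coset Ggp.mult_closed
      intro!: level_K_coset K_coset_left)

section \<open>Topology of \<open>G\<close> and \<open>X\<close>\<close>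

lemma dist_fls_eq:
  fixes x y :: "'q::{field,finite} fls"
  shows "dist x y = (if x = y then 0 else 2 powi (- fls_subdegree (x - y)))"
  by (auto simp: dist_fls_def power_int_def power_one_over inverse_eq_divide)

lemma two_powi_less_iff: "(2::real) powi m < 2 powi n \<longleftrightarrow> m < n"
proof
  assume *: "(2::real) powi m < 2 powi n"
  show "m < n"
  proof (rule ccontr)
    assume "\<not> m < n"
    then have "(2::real) powi n \<le> 2 powi m" by (intro power_int_increasing) auto
    from leD[OF this] * show False by (rule notE)
  qed
next
  assume "m < n"
  then show "(2::real) powi m < 2 powi n" by (rule power_int_strict_increasing) simp
qed

lemma pi_ideal_dist: "x - y \<in> pi_ideal n \<longleftrightarrow> dist x y < 2 powi (1 - n)"
proof (cases "x = y")
  case False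
  then have "dist x y < 2 powi (1 - n) \<longleftrightarrow> - fls_subdegree (x - y) < 1 - n"
    by (simp only: dist_fls_eq if_False two_powi_less_iff)
  with False show ?thesis unfolding pi_ideal_iff_subdegree by auto
next
  case True
  then show ?thesis by simp
qed

lemma small_power: 
  assumes "(r::real) > 0"
  obtains n :: int where "2 powi (1 - n) < r"
proof -
  obtain k where "(1 / 2) ^ k < r" using real_arch_pow_inv[of r "1/2"] assms by auto
  then have "2 powi (1 - (int k + 1)) < r"
    by (simp add: power_int_minus power_one_over inverse_eq_divide)
  then show thesis by (rule that)
qed

text \<open>
  Congruence modulo \<open>\<pi>\<^sup>n\<close>. These congruence classes form a basis of the topology on matrices
  (\<open>open_mat_near\<close>, \<open>open_imp_mat_near\<close>), which turns topological statements about \<open>G\<close> into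
  algebraic ones.
\<close>

definition mat_near :: "int \<Rightarrow> 'q::{field,finite} mat2 \<Rightarrow> 'q mat2 \<Rightarrow> bool" where
  "mat_near n A B \<longleftrightarrow> (\<forall>i j. B $ i $ j - A $ i $ j \<in> pi_ideal n)"

lemma open_pi_ideal_coset: "open {y. y - x \<in> pi_ideal n}"
proof -
  have "{y. y - x \<in> pi_ideal n} = ball x (2 powi (1 - n))"
    by (auto simp: pi_ideal_dist dist_commute)
  then show ?thesis by simp
qed

lemma open_mat_near: "open {B. mat_near n A B}"
proof -
  have "{B. mat_near n A B} = (\<Inter>i. \<Inter>j. (\<lambda>B. B $ i) -` ((\<lambda>r. r $ j) -` {y. y - A $ i $ j \<in> pi_ideal n}))"
    by (auto simp: mat_near_def)
  also have "open \<dots>"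
    by (intro open_INT finite ballI open_vimage_vec_nth open_pi_ideal_coset)
  finally show ?thesis .
qed

lemma open_imp_mat_near:
  assumes "open T" "A \<in> T"
  shows "\<exists>n. \<forall>B. mat_near n A B \<longrightarrow> B \<in> T"
proof -
  obtain e where e: "e > 0" "\<And>B. dist B A < e \<Longrightarrow> B \<in> T"
    using assms by (auto simp: open_dist)
  obtain n where n: "2 powi (1 - n) < e / 4" using small_power[of "e / 4"] e(1) by auto
  show ?thesis
  proof (intro exI allI impI)
    fix B assume B: "mat_near n A B"
    have "dist B A \<le> (\<Sum>i\<in>UNIV. dist (B $ i) (A $ i))"
      unfolding dist_vec_def by (rule L2_set_le_sum) simp
    also have "\<dots> \<le> (\<Sum>i\<in>UNIV. \<Sum>j\<in>UNIV. dist (B $ i $ j) (A $ i $ j))"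
      unfolding dist_vec_def[of "B $ i" "A $ i" for i] by (intro sum_mono L2_set_le_sum) simp
    also have "\<dots> < e"
      using B n by (simp add: sum_2 mat_near_def forall_2 pi_ideal_dist)
    finally show "B \<in> T" by (rule e(2))
  qed
qed

lemma openin_G_iff:
  "openin (top_of_set G_grp) S \<longleftrightarrow>
    S \<subseteq> G_grp \<and> (\<forall>A\<in>S. \<exists>n. \<forall>B\<in>G_grp. mat_near n A B \<longrightarrow> B \<in> S)"
proof (intro iffI conjI ballI)
  assume "openin (top_of_set G_grp) S"
  then obtain T where T: "open T" "S = G_grp \<inter> T" by (auto simp: openin_open)
  then show "S \<subseteq> G_grp" by auto
  fix A assume "A \<in> S"
  with T have "A \<in> T" by blast
  from open_imp_mat_near[OF T(1) this]
  show "\<exists>n. \<forall>B\<in>G_grp. mat_near n A B \<longrightarrow> B \<in> S" unfolding T(2) by blast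
next
  assume *: "S \<subseteq> G_grp \<and> (\<forall>A\<in>S. \<exists>n. \<forall>B\<in>G_grp. mat_near n A B \<longrightarrow> B \<in> S)"
  then have "\<forall>A\<in>S. \<exists>n. \<forall>B\<in>G_grp. mat_near n A B \<longrightarrow> B \<in> S" by (rule conjunct2)
  from bchoice[OF this] obtain N
    where N: "\<forall>A\<in>S. \<forall>B\<in>G_grp. mat_near (N A) A B \<longrightarrow> B \<in> S" by (rule exE)
  have self: "mat_near n A A" for n and A :: "'a mat2" by (simp add: mat_near_def)
  have "S = G_grp \<inter> (\<Union>A\<in>S. {B. mat_near (N A) A B})"
  proof (intro equalityI subsetI)
    fix A assume "A \<in> S"
    then show "A \<in> G_grp \<inter> (\<Union>A\<in>S. {B. mat_near (N A) A B})"
      using conjunct1[OF *] self[of "N A" A] by auto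
  next
    fix B assume "B \<in> G_grp \<inter> (\<Union>A\<in>S. {B. mat_near (N A) A B})"
    then show "B \<in> S" using N by auto
  qed
  moreover have "open (\<Union>A\<in>S. {B. mat_near (N A) A B})"
    by (intro open_UN ballI open_mat_near)
  ultimately show "openin (top_of_set G_grp) S" unfolding openin_open by blast
qed

lemma entries_bounded:
  fixes g :: "'q::{field,finite} mat2"
  shows "\<exists>M. \<forall>i j. g $ i $ j \<in> pi_ideal M"
proof (intro exI allI)
  fix i j
  have "Min (range (\<lambda>(i, j). fls_subdegree (g $ i $ j))) \<le> fls_subdegree (g $ i $ j)"
    by (rule Min_le) (auto intro: range_eqI[of _ _ "(i, j)"])
  then show "g $ i $ j \<in> pi_ideal (Min (range (\<lambda>(i, j). fls_subdegree (g $ i $ j))))"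
    by (simp add: pi_ideal_iff_subdegree)
qed

lemma mat_near_mult_right:
  fixes A B g :: "'q::{field,finite} mat2"
  assumes "mat_near n A B" "\<forall>i j. g $ i $ j \<in> pi_ideal M"
  shows "mat_near (n + M) (A ** g) (B ** g)"
  unfolding mat_near_def
proof (intro allI)
  fix i j
  have "(B ** g) $ i $ j - (A ** g) $ i $ j =
      (B $ i $ 1 - A $ i $ 1) * g $ 1 $ j + (B $ i $ 2 - A $ i $ 2) * g $ 2 $ j"
    unfolding matrix_matrix_mult_def sum_2 left_diff_distrib right_diff_distrib vec_lambda_beta
    by (rule add_diff_add)
  also have "\<dots> \<in> pi_ideal (n + M)"
    by (intro pi_ideal_add; rule pi_ideal_mult[OF assms(1)[unfolded mat_near_def, rule_format] assms(2)[rule_format]])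
      simp_all
  finally show "(B ** g) $ i $ j - (A ** g) $ i $ j \<in> pi_ideal (n + M)" .
qed

lemma mat_near_mult_left:
  fixes A B g :: "'q::{field,finite} mat2"
  assumes "mat_near n A B" "\<forall>i j. g $ i $ j \<in> pi_ideal M"
  shows "mat_near (n + M) (g ** A) (g ** B)"
  unfolding mat_near_def
proof (intro allI)
  fix i j
  have "(g ** B) $ i $ j - (g ** A) $ i $ j =
      g $ i $ 1 * (B $ 1 $ j - A $ 1 $ j) + g $ i $ 2 * (B $ 2 $ j - A $ 2 $ j)"
    unfolding matrix_matrix_mult_def sum_2 left_diff_distrib right_diff_distrib vec_lambda_beta
    by (rule add_diff_add)
  also have "\<dots> \<in> pi_ideal (n + M)"
    by (intro pi_ideal_add; rule pi_ideal_mult[OF assms(2)[rule_format] assms(1)[unfolded mat_near_def, rule_format]])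
      simp_all
  finally show "(g ** B) $ i $ j - (g ** A) $ i $ j \<in> pi_ideal (n + M)" .
qed

text \<open>
  The subgroup \<open>K\<close> is open: if \<open>B\<close> is close to \<open>A\<close>, then \<open>A\<^sup>-\<^sup>1 B\<close> is congruent to the identity
  modulo \<open>\<O>\<close>, hence integral.
\<close>

lemma K_coset_locally_constant:
  assumes "A \<in> G_grp"
  shows "\<exists>n. \<forall>B\<in>G_grp. mat_near n A B \<longrightarrow> K_coset B = K_coset A"
proof -
  obtain M where M: "\<forall>i j. mat2_inv A $ i $ j \<in> pi_ideal M" using entries_bounded by blast
  show ?thesis
  proof (intro exI ballI impI)
    fix B assume B: "B \<in> G_grp" "mat_near (- M) A B"
    have near: "mat_near 0 (mat 1) (mat2_inv A ** B)"
      using mat_near_mult_left[OF B(2) M] by (simp add: mat2_inv_left[OF assms])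
    have one: "(mat 1 :: 'a mat2) $ i $ j \<in> pi_ideal 0" for i j
      by (simp add: mat_def pi_ideal_iff_subdegree)
    have "(mat2_inv A ** B) $ i $ j \<in> pi_ideal 0" for i j
      using near pi_ideal_add[OF _ one, of "(mat2_inv A ** B) $ i $ j - mat 1 $ i $ j" i j]
      by (simp add: mat_near_def)
    moreover have "mat2_inv A ** B \<in> G_grp"
      using assms B by (intro Ggp.mult_closed Ggp.inv_closed)
    ultimately have "mat2_inv A ** B \<in> K_grp"
      by (simp add: SL2_def int_ring_eq_pi_ideal)
    then show "K_coset B = K_coset A"
      by (rule K_coset_eqI) (simp add: mat2_inv_cancel(2)[OF assms])
  qed
qed

lemma openin_coset_level: "openin X_top {x \<in> X_space. coset_level x = k}"
  unfolding openin_X_top openin_G_iff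
proof (intro conjI ballI)
  fix A :: "'a mat2"
  assume "A \<in> {g \<in> G_grp. Gamma_coset g \<in> {x \<in> X_space. coset_level x = k}}"
  then have A: "A \<in> G_grp" "level A = k" by (auto simp: coset_level_Gamma_coset)
  obtain n where "\<forall>B\<in>G_grp. mat_near n A B \<longrightarrow> K_coset B = K_coset A"
    using K_coset_locally_constant[OF A(1)] by blast
  then have "B \<in> {g \<in> G_grp. Gamma_coset g \<in> {x \<in> X_space. coset_level x = k}}"
    if "B \<in> G_grp" "mat_near n A B" for B
    using that A(2) level_K_coset[of B A] by (auto simp: coset_level_Gamma_coset X_space_def)
  then show "\<exists>n. \<forall>B\<in>G_grp. mat_near n A B \<longrightarrow> B \<in> {g \<in> G_grp. Gamma_coset g \<in> {x \<in> X_space. coset_level x = k}}"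
    by blast
qed auto

lemma openin_right_act_vimage:
  assumes "g \<in> G_grp" "openin X_top V"
  shows "openin X_top {x \<in> X_space. right_act x g \<in> V}"
  unfolding openin_X_top openin_G_iff
proof (intro conjI ballI)
  let ?P = "{h \<in> G_grp. Gamma_coset h \<in> {x \<in> X_space. right_act x g \<in> V}}"
  obtain M where M: "\<forall>i j. g $ i $ j \<in> pi_ideal M" using entries_bounded by blast
  fix A assume "A \<in> ?P"
  then have A: "A \<in> G_grp" "Gamma_coset (A ** g) \<in> V" by (auto simp: right_act_Gamma_coset)
  have "A ** g \<in> {h \<in> G_grp. Gamma_coset h \<in> V}" using A assms(1) by (auto intro: Ggp.mult_closed)
  with assms(2) obtain n where n: "\<forall>B\<in>G_grp. mat_near n (A ** g) B \<longrightarrow> Gamma_coset B \<in> V"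
    unfolding openin_X_top openin_G_iff by blast
  have "B \<in> ?P" if "B \<in> G_grp" "mat_near (n - M) A B" for B
    using n[rule_format, of "B ** g"] that mat_near_mult_right[OF that(2) M] assms(1)
    by (auto simp: right_act_Gamma_coset X_space_def intro: Ggp.mult_closed)
  then show "\<exists>n. \<forall>B\<in>G_grp. mat_near n A B \<longrightarrow> B \<in> ?P" by blast
qed auto

section \<open>Level distributions of probability measures on \<open>X\<close>\<close>

lemma sets_Borel_of: "sets (Borel_of T) = sigma_sets (topspace T) {V. openin T V}"
  unfolding Borel_of_def by (rule sets_measure_of) (auto dest: openin_subset)

lemma space_Borel_of: "space (Borel_of T) = topspace T"
  unfolding Borel_of_def by (rule space_measure_of) (auto dest: openin_subset)

text \<open>
  The common setting for \<open>\<mu>\<^sub>X\<close> on the whole space and \<open>\<nu>\<^sub>Y\<close> on the orbit: a Borel probability measure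
  on a subspace \<open>Z\<close> of \<open>X\<close>.
\<close>

locale coset_prob = prob_space M for M :: "'q::{field,finite} coset measure" +
  fixes Z
  assumes Z: "Z \<subseteq> X_space" and sets_M: "sets M = sets (Borel_of (subtopology X_top Z))"
begin

lemma space_M: "space M = Z"
  using sets_eq_imp_space_eq[OF sets_M] Z by (auto simp: space_Borel_of topspace_X_top)

lemma openin_in_sets: "openin X_top V \<Longrightarrow> V \<inter> Z \<in> sets M"
  unfolding sets_M sets_Borel_of by (rule sigma_sets.Basic) (auto simp: openin_subtopology)

lemma level_set_measurable:
  assumes "h \<in> G_grp"
  shows "{y \<in> space M. coset_level (right_act y h) = k} \<in> sets M"
proof -
  have "{y \<in> space M. coset_level (right_act y h) = k} =
      {x \<in> X_space. right_act x h \<in> {x \<in> X_space. coset_level x = k}} \<inter> Z"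
    using Z right_act_in_X[OF _ assms] by (auto simp: space_M)
  also have "\<dots> \<in> sets M"
    by (intro openin_in_sets openin_right_act_vimage assms openin_coset_level)
  finally show ?thesis .
qed

lemma right_act_measurable:
  assumes g: "g \<in> G_grp" and closed: "\<And>y. y \<in> Z \<Longrightarrow> right_act y g \<in> Z"
  shows "(\<lambda>y. right_act y g) \<in> measurable M M"
proof -
  have "(\<lambda>y. right_act y g) \<in> measurable M (Borel_of (subtopology X_top Z))"
    unfolding Borel_of_def
  proof (rule measurable_measure_of)
    show "{V. openin (subtopology X_top Z) V} \<subseteq> Pow (topspace (subtopology X_top Z))"
      using openin_subset by blast
    show "(\<lambda>y. right_act y g) \<in> space M \<rightarrow> topspace (subtopology X_top Z)"
      using closed Z by (auto simp: space_M topspace_X_top)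
    fix V assume "V \<in> {V. openin (subtopology X_top Z) V}"
    then obtain T where T: "openin X_top T" "V = T \<inter> Z" by (auto simp: openin_subtopology)
    have "(\<lambda>y. right_act y g) -` V \<inter> space M = {x \<in> X_space. right_act x g \<in> T} \<inter> Z"
      using T closed Z by (auto simp: space_M)
    then show "(\<lambda>y. right_act y g) -` V \<inter> space M \<in> sets M"
      using openin_in_sets[OF openin_right_act_vimage[OF g T(1)]] by simp
  qed
  then show ?thesis using measurable_cong_sets[OF refl sets_M] by blast
qed

text \<open>
  The distribution of the level of \<open>y h\<close> for a random point \<open>y\<close>. Both sides of the theorem are of
  this kind, with \<open>h = 1\<close> for \<open>\<mu>\<^sub>X\<close> and \<open>h = a\<^bsub>-n\<^esub>\<close> for \<open>\<nu>\<^sub>Y\<close>.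
\<close>

definition level_prob :: "'q mat2 \<Rightarrow> nat \<Rightarrow> real" where
  "level_prob h k = prob {y \<in> space M. coset_level (right_act y h) = k}"

lemma level_prob_K_coset:
  assumes "A \<in> G_grp" "B \<in> G_grp" "K_coset A = K_coset B"
  shows "level_prob A k = level_prob B k"
  unfolding level_prob_def using Z coset_level_right_act_K_coset[OF _ assms]
  by (intro arg_cong[where f = prob] Collect_cong) (auto simp: space_M)

lemma level_prob_invariant:
  assumes g: "g \<in> G_grp" and closed: "\<And>y. y \<in> Z \<Longrightarrow> right_act y g \<in> Z"
    and inv: "distr M M (\<lambda>y. right_act y g) = M" and h: "h \<in> G_grp"
  shows "level_prob (g ** h) k = level_prob h k"
proof -
  note meas = right_act_measurable[OF g closed]
  have "level_prob h k = measure (distr M M (\<lambda>y. right_act y g)) {y \<in> space M. coset_level (right_act y h) = k}"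
    by (simp add: level_prob_def inv)
  also have "\<dots> = prob ((\<lambda>y. right_act y g) -` {y \<in> space M. coset_level (right_act y h) = k} \<inter> space M)"
    by (rule measure_distr[OF meas level_set_measurable[OF h]])
  also have "(\<lambda>y. right_act y g) -` {y \<in> space M. coset_level (right_act y h) = k} \<inter> space M =
      {y \<in> space M. coset_level (right_act y (g ** h)) = k}"
    using closed by (auto simp: space_M right_act_right_act)
  finally show ?thesis by (simp add: level_prob_def)
qed

text \<open>
  The integrated form of \<open>hecke_level_sum\<close>, applied to the indicator function of level \<open>k\<close>: level
  \<open>k\<close> is reached from the levels \<open>k - 1\<close>, \<open>k\<close> and \<open>k + 1\<close> only.
\<close>

lemma hecke_level_prob:
  assumes h: "h \<in> G_grp"
  defines "q \<equiv> real CARD('q)"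
  shows "(\<Sum>i\<in>UNIV. level_prob (h ** hecke_rep i) k) =
    (if k = 0 then (q\<^sup>2 - 1) * level_prob h 0
     else if k = 1 then (q + 1) * level_prob h 0 + (q - 1) * level_prob h 1
     else level_prob h (k - 1) + (q - 1) * level_prob h k)
    + q\<^sup>2 * level_prob h (k + 1)"
proof -
  define S where "S A j = {y \<in> space M. coset_level (right_act y A) = j}" for A j
  have meas: "S A j \<in> sets M" if "A \<in> G_grp" for A j
    using level_set_measurable[OF that] by (simp add: S_def)
  have lp: "level_prob A j = (LINT y|M. indicator (S A j) y)" if "A \<in> G_grp" for A j
    using meas[OF that] by (simp add: level_prob_def S_def)
  have int: "integrable M (indicator (S A j) :: _ \<Rightarrow> real)" if "A \<in> G_grp" for A j
    using meas[OF that] by (simp add: emeasure_eq_measure)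
  have hG: "h ** hecke_rep i \<in> G_grp" for i by (intro Ggp.mult_closed h hecke_rep_in_G)
  \<comment> \<open>The number of Hecke steps into level \<open>k\<close> from one point of level \<open>k - 1\<close> and of level \<open>k\<close>; for \<open>k = 0\<close> the truncated \<open>k - 1\<close> must not count.\<close>
  define a b :: real where "a = (if k = 0 then 0 else if k = 1 then q + 1 else 1)"
    and "b = (if k = 0 then q\<^sup>2 - 1 else q - 1)"
  have pt: "(\<Sum>i\<in>UNIV. indicator (S (h ** hecke_rep i) k) y) =
      a * indicator (S h (k - 1)) y + b * indicator (S h k) y + q\<^sup>2 * (indicator (S h (k + 1)) y :: real)"
    if "y \<in> space M" for y
  proof -
    from that Z obtain g where g: "g \<in> G_grp" "y = Gamma_coset g" by (auto simp: space_M X_space_def)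
    have gh: "g ** h \<in> G_grp" by (intro Ggp.mult_closed g h)
    have ind: "indicator (S A j) y = (of_bool (level (g ** A) = j) :: real)" if "A \<in> G_grp" for A j
      using \<open>y \<in> space M\<close> that g
      by (simp add: S_def right_act_Gamma_coset coset_level_Gamma_coset Ggp.mult_closed)
    have "(\<Sum>i\<in>UNIV. indicator (S (h ** hecke_rep i) k) y) =
        (\<Sum>i\<in>UNIV. (of_bool (level (g ** h ** hecke_rep i) = k) :: real))"
      by (simp add: ind[OF hG] matrix_mul_assoc)
    also have "\<dots> = (if level (g ** h) = 0 then (q + 1) * of_bool (1 = k) + (q\<^sup>2 - 1) * of_bool (0 = k)
       else of_bool (level (g ** h) + 1 = k) + (q - 1) * of_bool (level (g ** h) = k)
        + q\<^sup>2 * of_bool (level (g ** h) - 1 = k))"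
      unfolding q_def by (rule hecke_level_sum[OF gh])
    also have "\<dots> = a * of_bool (level (g ** h) = k - 1) + b * of_bool (level (g ** h) = k)
        + q\<^sup>2 * of_bool (level (g ** h) = k + 1)"
      by (auto simp: a_def b_def)
    finally show ?thesis by (simp add: ind[OF h])
  qed
  have "(\<Sum>i\<in>UNIV. level_prob (h ** hecke_rep i) k) = 
      (LINT y|M. (\<Sum>i\<in>UNIV. indicator (S (h ** hecke_rep i) k) y))"
    by (simp add: lp[OF hG] int[OF hG])
  also have "\<dots> = (LINT y|M. a * indicator (S h (k - 1)) y + b * indicator (S h k) y
      + q\<^sup>2 * (indicator (S h (k + 1)) y :: real))"
    by (rule Bochner_Integration.integral_cong[OF refl pt])
  also have "\<dots> = a * level_prob h (k - 1) + b * level_prob h k + q\<^sup>2 * level_prob h (k + 1)"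
    by (simp add: lp[OF h] int[OF h])
  finally show ?thesis by (auto simp: a_def b_def)
qed

lemma integral_level_function:
  fixes F :: "'q coset \<Rightarrow> complex"
  assumes h: "h \<in> G_grp" and F: "\<And>y. y \<in> space M \<Longrightarrow> F y = \<phi> (coset_level (right_act y h))"
    and supp: "\<And>k. k \<ge> N \<Longrightarrow> \<phi> k = 0"
  shows "(LINT y|M. F y) = (\<Sum>k<N. of_real (level_prob h k) * \<phi> k)"
proof -
  define S where "S j = {y \<in> space M. coset_level (right_act y h) = j}" for j
  have meas: "S j \<in> sets M" for j
    using level_set_measurable[OF h] by (simp add: S_def)
  have "(LINT y|M. F y) = (LINT y|M. (\<Sum>k<N. indicator (S k) y *\<^sub>R \<phi> k))"
  proof (rule Bochner_Integration.integral_cong[OF refl])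
    fix y assume y: "y \<in> space M"
    have "(\<Sum>k<N. indicator (S k) y *\<^sub>R \<phi> k) = (\<Sum>k<N. if coset_level (right_act y h) = k then \<phi> k else 0)"
      using y by (intro sum.cong refl) (simp add: S_def)
    also have "\<dots> = \<phi> (coset_level (right_act y h))"
      using supp by (simp add: not_less)
    finally show "F y = (\<Sum>k<N. indicator (S k) y *\<^sub>R \<phi> k)" by (simp add: F[OF y])
  qed
  also have "\<dots> = (\<Sum>k<N. LINT y|M. indicator (S k) y *\<^sub>R \<phi> k)"
    using meas by (intro Bochner_Integration.integral_sum integrable_scaleR_left) (simp add: emeasure_eq_measure)
  also have "\<dots> = (\<Sum>k<N. of_real (level_prob h k) * \<phi> k)"
    using meas by (intro sum.cong refl) (simp add: emeasure_eq_measure level_prob_def S_def[symmetric] scaleR_conv_of_real)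
  finally show ?thesis .
qed

end

section \<open>The two distributions on levels\<close>

text \<open>
  The masses \<open>\<mu>\<^sub>X(\<Gamma> a\<^sub>k K)\<close>, which are proportional to the inverse orders of the stabilizers in
  \<open>\<Gamma>\<close> of the vertices \<open>v\<^sub>2\<^sub>k\<close>.
\<close>

definition stationary_prob :: "real \<Rightarrow> nat \<Rightarrow> real" where
  "stationary_prob q k = (if k = 0 then (q - 1) / q else (q\<^sup>2 - 1) / q ^ (2 * k + 1))"

text \<open>
  A stationary distribution of a walk with steps of size at most one satisfies detailed balance: the
  flow from level \<open>k\<close> to \<open>k + 1\<close> equals the flow back. Thus \<open>(q + 1) p\<^sub>0 = q\<^sup>2 p\<^sub>1\<close> and
  \<open>p\<^sub>k = q\<^sup>2 p\<^bsub>k+1\<^esub>\<close> for \<open>k \<ge> 1\<close>, so the \<open>p\<^sub>k\<close> with \<open>k \<ge> 1\<close> form a geometric sequence and the total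
  mass determines \<open>p\<^sub>0\<close>.
\<close>

lemma stationary_prob_unique:
  fixes q :: real and p :: "nat \<Rightarrow> real"
  assumes q: "q > 1" and sums: "p sums 1"
    and rec: "\<And>k. (q\<^sup>2 + q) * p k =
      (if k = 0 then (q\<^sup>2 - 1) * p 0
       else if k = 1 then (q + 1) * p 0 + (q - 1) * p 1
       else p (k - 1) + (q - 1) * p k)
      + q\<^sup>2 * p (k + 1)"
  shows "p k = stationary_prob q k"
proof -
  have flux0: "(q + 1) * p 0 = q\<^sup>2 * p 1"
    using rec[of 0] by (simp add: algebra_simps)
  have down: "p (k + 1) = q\<^sup>2 * p (k + 2)" for k
  proof (induction k)
    case 0
    have "(q\<^sup>2 + q) * p 1 = (q + 1) * p 0 + (q - 1) * p 1 + q\<^sup>2 * p 2"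
      using rec[of 1] by (simp add: numeral_2_eq_2)
    then have "(q\<^sup>2 + q) * p 1 = q\<^sup>2 * p 1 + (q - 1) * p 1 + q\<^sup>2 * p 2"
      unfolding flux0 .
    then show ?case by (simp add: algebra_simps numeral_2_eq_2)
  next
    case (Suc k)
    then show ?case using rec[of "k + 2"] by (simp add: algebra_simps numeral_3_eq_3)
  qed
  have geo: "p (Suc k) = p 1 * (1 / q\<^sup>2) ^ k" for k
  proof (induction k)
    case (Suc k)
    have "p (Suc (Suc k)) = p (Suc k) / q\<^sup>2" using down[of k] q by simp
    with Suc show ?case by simp
  qed simp
  have "norm (1 / q\<^sup>2) < 1" using q by (simp add: abs_square_less_1 flip: power_divide)
  from geometric_sums[OF this] have "(\<lambda>k. p 1 * (1 / q\<^sup>2) ^ k) sums (p 1 * (1 / (1 - 1 / q\<^sup>2)))"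
    by (rule sums_mult)
  then have "(\<lambda>k. p (Suc k)) sums (p 1 * (1 / (1 - 1 / q\<^sup>2)))" by (simp only: geo)
  from sums_Suc[OF this] sums have total: "p 1 * (1 / (1 - 1 / q\<^sup>2)) + p 0 = 1"
    using sums_unique2 by blast
  have "q * q > 1" using q by (metis less_1_mult)
  then have nz: "q\<^sup>2 - 1 \<noteq> 0" by (simp add: power2_eq_square)
  have p1: "p 1 = (q + 1) * p 0 / q\<^sup>2" using flux0 q by (simp add: field_simps)
  have "1 / (1 - 1 / q\<^sup>2) = q\<^sup>2 / ((q - 1) * (q + 1))"
    using q nz by (simp add: field_simps power2_eq_square)
  then have "p 1 * (1 / (1 - 1 / q\<^sup>2)) = ((q + 1) * p 0 / q\<^sup>2) * (q\<^sup>2 / ((q - 1) * (q + 1)))"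
    unfolding p1 by simp
  also have "\<dots> = p 0 / (q - 1)"
    using q by (simp add: divide_simps)
  finally have "p 0 / (q - 1) + p 0 = 1" using total by simp
  then have p0: "p 0 = (q - 1) / q" using q by (simp add: field_simps)
  show ?thesis
  proof (cases k)
    case 0
    then show ?thesis by (simp add: p0 stationary_prob_def)
  next
    case (Suc j)
    have "p k = (q\<^sup>2 - 1) / q ^ 3 * (1 / q\<^sup>2) ^ j"
      unfolding Suc geo p1 p0 using q by (simp add: field_simps power2_eq_square power3_eq_cube)
    also have "\<dots> = (q\<^sup>2 - 1) / q ^ (2 * k + 1)"
      by (simp add: Suc power_divide power_add eval_nat_numeral power_mult_distrib flip: power_mult)
    finally show ?thesis by (simp add: stationary_prob_def Suc)
  qed
qed

text \<open>
  The distribution of levels on the horocycle at distance \<open>2 N\<close> below the one that consists of points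
  of level \<open>0\<close>: stationary below \<open>N\<close>, with the whole tail of the stationary distribution collected in
  level \<open>N\<close>. The tail is \<open>q\<^bsup>1-2N\<^esup>\<close> for \<open>N > 0\<close> and the total mass for \<open>N = 0\<close>.
\<close>

definition horocycle_prob :: "real \<Rightarrow> nat \<Rightarrow> nat \<Rightarrow> real" where
  "horocycle_prob q N k =
    (if k < N then stationary_prob q k else if k = N then (if N = 0 then 1 else q / q ^ (2 * N)) else 0)"

text \<open>
  In the interior this is stationarity. Near \<open>k = N\<close> the collected tail matches because it is
  \<open>q\<^sup>2 / (q\<^sup>2 - 1)\<close> times the stationary mass of level \<open>N\<close> when \<open>N > 0\<close>.
\<close>

lemma horocycle_prob_rec:
  fixes q :: real
  assumes q: "q > 1"
  shows "q\<^sup>2 * horocycle_prob q (N + 2) k =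
    (if k = 0 then (q\<^sup>2 - q) * horocycle_prob q (N + 1) 0
     else if k = 1 then (q + 1) * horocycle_prob q (N + 1) 0
     else horocycle_prob q (N + 1) (k - 1))
    + q\<^sup>2 * horocycle_prob q (N + 1) (k + 1) - horocycle_prob q N k"
proof -
  have q0: "q \<noteq> 0" using q by simp
  consider "k = 0" | "k = 1" | j where "k = Suc (Suc j)"
    by (metis One_nat_def nat.exhaust)
  then show ?thesis
  proof cases
    case 1
    then show ?thesis using q0
      by (cases N) (auto simp: horocycle_prob_def stationary_prob_def field_simps power2_eq_square)
  next
    case 2
    consider "N = 0" | "N = 1" | "N \<ge> 2" by linarith
    then show ?thesis using q0 2
      by cases (auto simp: horocycle_prob_def stationary_prob_def field_simps power2_eq_square eval_nat_numeral)
  next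
    case 3
    consider "j > N" | "j = N" | "N = Suc j" | "N = Suc (Suc j)" | "N > Suc (Suc j)" by linarith
    then show ?thesis using q0 3
      by cases (auto simp: horocycle_prob_def stationary_prob_def field_simps power2_eq_square eval_nat_numeral)
  qed
qed

text \<open>
  The recursion determines \<open>P (n + 1)\<close> from \<open>P n\<close> and \<open>P (n - 1)\<close>. Its left hand side counts the Hecke
  neighbours of a horocycle by the horocycle on which they lie, its right hand side counts them by
  level.
\<close>

lemma horocycle_prob_unique:
  fixes q :: real and P :: "int \<Rightarrow> nat \<Rightarrow> real"
  assumes q: "q > 1" and P0: "\<And>k. P 0 k = of_bool (k = 0)" and Pm1: "\<And>k. P (-1) k = of_bool (k = 1)"
    and rec: "\<And>n k. q\<^sup>2 * P (n + 1) k + P (n - 1) k + (q - 1) * P n k =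
      (if k = 0 then (q\<^sup>2 - 1) * P n 0
       else if k = 1 then (q + 1) * P n 0 + (q - 1) * P n 1
       else P n (k - 1) + (q - 1) * P n k)
      + q\<^sup>2 * P n (k + 1)"
  shows "P (int N) k = horocycle_prob q N k"
proof -
  have q0: "q\<^sup>2 \<noteq> 0" using q by simp
  have rec': "q\<^sup>2 * P (n + 1) k =
    (if k = 0 then (q\<^sup>2 - q) * P n 0 else if k = 1 then (q + 1) * P n 0 else P n (k - 1))
    + q\<^sup>2 * P n (k + 1) - P (n - 1) k" for n k
    using rec[of n k] by (auto simp: algebra_simps split: if_splits)
  have "(\<forall>k. P (int N) k = horocycle_prob q N k) \<and> (\<forall>k. P (int N + 1) k = horocycle_prob q (N + 1) k)"
  proof (induction N)
    case 0
    have "q\<^sup>2 * (q - 1) / q = q\<^sup>2 - q" using q by (simp add: field_simps power2_eq_square)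
    then have "q\<^sup>2 * P 1 k = q\<^sup>2 * horocycle_prob q 1 k" for k
      using rec'[of 0 k] q by (auto simp: P0 Pm1 horocycle_prob_def stationary_prob_def)
    then show ?case using q0 by (auto simp: P0 horocycle_prob_def)
  next
    case (Suc N)
    have "q\<^sup>2 * P (int N + 2) k = q\<^sup>2 * horocycle_prob q (N + 2) k" for k
      using rec'[of "int N + 1" k] horocycle_prob_rec[OF q, of N k] Suc by (simp add: add.commute)
    then show ?case using q0 Suc by (simp add: add.commute)
  qed
  then show ?thesis by blast
qed

lemma card_field_gt_1: "1 < real CARD('q::{field,finite})"
proof -
  have "card {0, 1 :: 'q} \<le> CARD('q)" by (intro card_mono) auto
  then show ?thesis by simp
qed

section \<open>The invariant measure on \<open>X\<close>\<close>

context coset_prob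
begin

lemma level_prob_sums: 
  assumes "h \<in> G_grp"
  shows "level_prob h sums 1"
proof -
  have "(\<lambda>k. prob {y \<in> space M. coset_level (right_act y h) = k}) sums
      prob (\<Union>k. {y \<in> space M. coset_level (right_act y h) = k})"
    using level_set_measurable[OF assms] by (intro finite_measure_UNION) (auto simp: disjoint_family_on_def)
  also have "(\<Union>k. {y \<in> space M. coset_level (right_act y h) = k}) = space M" by auto
  finally show ?thesis by (simp add: level_prob_def[abs_def] prob_space)
qed

end

lemma coset_prob_X:
  assumes "invariant_prob_X \<mu>"
  shows "coset_prob \<mu> X_space"
  using assms unfolding invariant_prob_X_def coset_prob_def coset_prob_axioms_def
  by (simp flip: topspace_X_top)

text \<open>
  By invariance each of the \<open>q\<^sup>2 + q\<close> Hecke neighbours of a random point has the distribution of that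
  point, which is the stationarity condition.
\<close>

lemma level_prob_X:
  fixes \<mu> :: "'q::{field,finite} coset measure"
  assumes "invariant_prob_X \<mu>"
  shows "coset_prob.level_prob \<mu> (mat 1) k = stationary_prob (real CARD('q)) k"
proof -
  interpret coset_prob \<mu> X_space by (rule coset_prob_X[OF assms])
  let ?q = "real CARD('q)"
  have one: "mat 1 \<in> (G_grp :: 'q mat2 set)" by (rule Ggp.one_closed)
  have rep: "level_prob (mat 1 ** hecke_rep i) k = level_prob (mat 1) k" for i k
  proof -
    have "distr \<mu> \<mu> (\<lambda>y. right_act y (hecke_rep i)) = \<mu>"
      using assms hecke_rep_in_G unfolding invariant_prob_X_def by blast
    then have "level_prob (hecke_rep i ** mat 1) k = level_prob (mat 1) k"
      by (intro level_prob_invariant hecke_rep_in_G right_act_in_X one)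
    then show ?thesis by simp
  qed
  show ?thesis
  proof (rule stationary_prob_unique)
    show "1 < ?q" by (rule card_field_gt_1)
    show "level_prob (mat 1) sums 1" by (rule level_prob_sums[OF one])
    fix k
    have "(?q\<^sup>2 + ?q) * level_prob (mat 1) k = (\<Sum>i\<in>(UNIV :: (('q \<times> 'q) + 'q) set). level_prob (mat 1 ** hecke_rep i) k)"
      unfolding rep by (simp add: power2_eq_square)
    with hecke_level_prob[OF one, of k] show "(?q\<^sup>2 + ?q) * level_prob (mat 1) k =
      (if k = 0 then (?q\<^sup>2 - 1) * level_prob (mat 1) 0
       else if k = 1 then (?q + 1) * level_prob (mat 1) 0 + (?q - 1) * level_prob (mat 1) 1
       else level_prob (mat 1) (k - 1) + (?q - 1) * level_prob (mat 1) k)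
      + ?q\<^sup>2 * level_prob (mat 1) (k + 1)" by simp
  qed
qed

section \<open>Compact orbits of \<open>U\<close>\<close>

lemma diag_mat_u_commute: "\<alpha> \<noteq> 0 \<Longrightarrow> diag_mat \<alpha> ** u_mat s = u_mat (\<alpha> * \<alpha> * s) ** diag_mat \<alpha>"
  by (simp add: mat_defs)

lemma U_orbit_shift: "U_orbit (right_act x (u_mat s)) = U_orbit x"
proof -
  have "U_orbit (right_act x (u_mat s)) = range ((\<lambda>t. right_act x (u_mat t)) \<circ> (\<lambda>t. s + t))"
    by (simp add: U_orbit_def right_act_right_act u_mat_mult comp_def)
  also have "\<dots> = U_orbit x"
    unfolding image_comp[symmetric] U_orbit_def by simp
  finally show ?thesis .
qed

lemma compactin_level_bounded:
  assumes "compactin X_top Y"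
  obtains B where "\<And>y. y \<in> Y \<Longrightarrow> coset_level y \<le> B"
proof -
  let ?V = "\<lambda>k. {x \<in> X_space. coset_level x = k}"
  have Y: "Y \<subseteq> X_space" using assms compactin_subset_topspace topspace_X_top by blast
  then have cover: "Y \<subseteq> \<Union> (range ?V)" by auto
  obtain F where F: "finite F" "F \<subseteq> range ?V" "Y \<subseteq> \<Union> F"
    using compactinD[OF assms _ cover] openin_coset_level by auto
  have "finite (coset_level ` \<Union> F)"
  proof -
    have "finite (coset_level ` V)" if "V \<in> F" for V
    proof -
      from that F(2) obtain k where "V = ?V k" by auto
      then have "coset_level ` V \<subseteq> {k}" by auto
      then show ?thesis by (rule finite_subset) simp
    qed
    with F(1) show ?thesis by (simp add: image_Union)
  qed
  then have "coset_level y \<le> Max (coset_level ` \<Union> F)" if "y \<in> Y" for y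
    using that F(3) by (intro Max_ge) auto
  then show thesis by (rule that)
qed

text \<open>
  Let \<open>B\<close> bound the levels on \<open>Y\<close>. Reduction theory for \<open>g a\<^sub>N\<close> with \<open>N > B\<close> yields \<open>\<gamma>\<close> in \<open>\<Gamma>\<close> such
  that the lower left entry \<open>c\<close> of \<open>h = \<gamma>\<^sup>-\<^sup>1 g\<close> lies in \<open>\<pi>\<^sup>N \<O>\<close>. If \<open>c\<close> were nonzero, then with
  \<open>s = - d / c\<close> the lower row of \<open>h u(s)\<close> would be \<open>(c, 0)\<close>, so that \<open>g u(s)\<close> would have level at
  least \<open>N\<close>. Hence \<open>h\<close> is upper triangular, and its unipotent part is absorbed by the orbit.
\<close>

lemma compact_U_orbit_diagonal:
  fixes Y :: "'q::{field,finite} coset set"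
  assumes "compact_U_orbit Y"
  obtains \<alpha> where "\<alpha> \<noteq> 0" "Y = U_orbit (Gamma_coset (diag_mat \<alpha>))"
proof -
  from assms obtain g where g: "g \<in> G_grp" "Y = U_orbit (Gamma_coset g)" and comp: "compactin X_top Y"
    by (auto simp: compact_U_orbit_def)
  obtain B where B: "\<And>y. y \<in> Y \<Longrightarrow> coset_level y \<le> B"
    using compactin_level_bounded[OF comp] by blast
  have bound: "level (g ** u_mat s) \<le> B" for s
  proof -
    have "right_act (Gamma_coset g) (u_mat s) \<in> Y" by (auto simp: g U_orbit_def)
    from B[OF this] show ?thesis
      using g by (simp add: right_act_Gamma_coset coset_level_Gamma_coset Ggp.mult_closed)
  qed
  let ?N = "int B + 1"
  define k where "k = level (g ** a_mat ?N)"
  have "g ** a_mat ?N \<in> G_grp" using g by (intro Ggp.mult_closed) auto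
  from level_decomp[OF this] obtain \<gamma> \<kappa> where \<gamma>: "\<gamma> \<in> Gamma_grp" and \<kappa>: "\<kappa> \<in> K_grp"
    and dec: "g ** a_mat ?N = \<gamma> ** a_mat (int k) ** \<kappa>" unfolding k_def by blast
  have "g = g ** a_mat ?N ** a_mat (- ?N)"
    by (simp add: a_mat_mult a_mat_0 flip: matrix_mul_assoc)
  then have gdec: "g = \<gamma> ** (a_mat (int k) ** \<kappa> ** a_mat (- ?N))"
    by (simp only: dec matrix_mul_assoc)
  define h where "h = a_mat (int k) ** \<kappa> ** a_mat (- ?N)"
  have hG: "h \<in> G_grp"
    unfolding h_def by (intro Ggp.mult_closed) (auto intro: SL2_in_G[OF \<kappa>])
  have gh: "g = \<gamma> ** h" using gdec by (simp add: h_def)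
  obtain a b c d where abcd: "h = mk_mat2 a b c d" by (rule mat2_exhaust)
  have det: "a * d - b * c = 1" using hG by (simp add: abcd)
  have c: "c \<in> pi_ideal ?N"
  proof -
    obtain k1 k2 k3 k4 where kk: "\<kappa> = mk_mat2 k1 k2 k3 k4" by (rule mat2_exhaust)
    with \<kappa> have "k3 \<in> pi_ideal 0" by (simp add: int_ring_eq_pi_ideal)
    moreover have "c = t_pow (- int B - 1 - int k) * k3"
    proof -
      have "t_pow (- int k) * k3 * t_pow (- int B - 1) = c"
        using abcd by (simp add: h_def kk a_mat_eq_diag_mat diag_mat_def)
      then show ?thesis by (simp add: mult.assoc mult.commute[of k3])
    qed
    ultimately show ?thesis
      by (auto simp: mult_mem_pi_ideal_iff elim: pi_ideal_mono)
  qed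
  have "c = 0"
  proof (rule ccontr)
    assume "c \<noteq> 0"
    have "b = (a * d - 1) / c" using det \<open>c \<noteq> 0\<close> by (simp add: field_simps)
    then have "h ** u_mat (- d / c) = u_mat (a / c) ** diag_mat (inverse c) ** weyl"
      using \<open>c \<noteq> 0\<close> by (simp add: abcd mat_defs) (simp add: field_simps)
    then have "level (h ** u_mat (- d / c)) = level (u_mat (a / c) ** diag_mat (inverse c))"
      by (simp add: level_mult_K)
    also have "\<dots> = level (u_mat (a / c) ** a_mat (fls_subdegree c))"
      using K_coset_diag_mat[of "inverse c"] \<open>c \<noteq> 0\<close> by (intro level_K_coset K_coset_left) simp
    also have "\<dots> = nat (fls_subdegree c)"
      using c \<open>c \<noteq> 0\<close> by (intro level_u_a_nonneg) (simp add: pi_ideal_iff_subdegree)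
    finally have "level (g ** u_mat (- d / c)) = nat (fls_subdegree c)"
      by (simp add: gh level_mult_left[OF \<gamma>] flip: matrix_mul_assoc)
    with bound[of "- d / c"] c \<open>c \<noteq> 0\<close> show False
      by (simp add: pi_ideal_iff_subdegree)
  qed
  with det have ad: "a * d = 1" by simp
  then have "a \<noteq> 0" "d = inverse a" by (auto dest: inverse_unique)
  then have "h = diag_mat a ** u_mat (b / a)"
    using \<open>c = 0\<close> by (simp add: abcd mat_defs)
  then have "Gamma_coset g = right_act (Gamma_coset (diag_mat a)) (u_mat (b / a))"
    by (simp add: gh Gamma_coset_mult_left[OF \<gamma>] right_act_Gamma_coset)
  then have "Y = U_orbit (Gamma_coset (diag_mat a))"
    by (simp add: g U_orbit_shift)
  with \<open>a \<noteq> 0\<close> show thesis by (rule that)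
qed

lemma U_orbit_diagonal_iff:
  "y \<in> U_orbit (Gamma_coset (diag_mat \<alpha>)) \<longleftrightarrow> (\<exists>s. y = Gamma_coset (diag_mat \<alpha> ** u_mat s))"
  by (auto simp: U_orbit_def right_act_Gamma_coset)

lemma Lambda_U_diagonal:
  assumes "\<alpha> \<noteq> 0"
  shows "Lambda_U (U_orbit (Gamma_coset (diag_mat \<alpha>))) = {s. \<alpha> * \<alpha> * s \<in> poly_ring}"
proof -
  have stab: "param_stabilizer (Gamma_coset (diag_mat \<alpha> ** u_mat s')) = {s. \<alpha> * \<alpha> * s \<in> poly_ring}" for s'
  proof (intro set_eqI)
    fix s
    let ?g = "diag_mat \<alpha> ** u_mat s'"
    have gG: "?g \<in> G_grp" using assms by (intro Ggp.mult_closed) auto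
    have shift: "?g ** u_mat s = u_mat (\<alpha> * \<alpha> * s) ** ?g"
      using assms by (simp add: mat_defs algebra_simps)
    have "Gamma_coset (u_mat (\<alpha> * \<alpha> * s) ** ?g) = Gamma_coset ?g \<longleftrightarrow> \<alpha> * \<alpha> * s \<in> poly_ring"
    proof
      assume "Gamma_coset (u_mat (\<alpha> * \<alpha> * s) ** ?g) = Gamma_coset ?g"
      then obtain \<gamma> where "\<gamma> \<in> Gamma_grp" "u_mat (\<alpha> * \<alpha> * s) ** ?g = \<gamma> ** ?g"
        by (rule Gamma_coset_eqD)
      then have "u_mat (\<alpha> * \<alpha> * s) \<in> Gamma_grp"
        using mat2_inv_cancel(4)[OF gG] by metis
      then show "\<alpha> * \<alpha> * s \<in> poly_ring" by simp
    qed (simp add: Gamma_coset_mult_left)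
    then show "s \<in> param_stabilizer (Gamma_coset ?g) \<longleftrightarrow> s \<in> {s. \<alpha> * \<alpha> * s \<in> poly_ring}"
      by (simp add: param_stabilizer_def right_act_Gamma_coset shift del: mk_mat2_mult)
  qed
  show ?thesis
    unfolding Lambda_U_def U_orbit_diagonal_iff[abs_def] Ball_def
    by (rule the_equality) (use stab in \<open>auto simp: U_orbit_diagonal_iff\<close>)
qed

section \<open>Haar measure and the level of an orbit\<close>

lemma normalized_Haar_shift:
  assumes "normalized_Haar ds" "A \<in> sets borel"
  shows "emeasure ds {x. x - s \<in> A} = emeasure ds A" and "{x. x - s \<in> A} \<in> sets borel"
proof -
  have "continuous_on UNIV (\<lambda>x. - s + x :: 'a fls)"
  proof (rule continuous_onI)
    fix x e assume "(e::real) > 0"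
    have "dist (- s + x') (- s + x) = dist x' x" for x' :: "'a fls"
      by (simp add: dist_fls_def)
    with \<open>e > 0\<close> show "\<exists>d>0. \<forall>x'\<in>UNIV. dist x' x < d \<longrightarrow> dist (- s + x') (- s + x) \<le> e"
      by (auto intro!: exI[of _ e])
  qed
  then have meas: "(\<lambda>x. - s + x) \<in> borel_measurable borel"
    by (rule borel_measurable_continuous_onI)
  have sets: "sets ds = sets borel" and inv: "distr ds borel (\<lambda>x. - s + x) = ds"
    using assms(1) unfolding normalized_Haar_def by blast+
  have meas': "(\<lambda>x. - s + x) \<in> measurable ds borel"
    using meas measurable_cong_sets[OF sets refl] by blast
  have space: "space ds = UNIV" using sets_eq_imp_space_eq[OF sets] by simp
  have "emeasure ds A = emeasure (distr ds borel (\<lambda>x. - s + x)) A" by (simp only: inv)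
  also have "\<dots> = emeasure ds ((\<lambda>x. - s + x) -` A \<inter> space ds)"
    by (rule emeasure_distr[OF meas' assms(2)])
  also have "(\<lambda>x. - s + x) -` A \<inter> space ds = {x. x - s \<in> A}"
    by (auto simp: space)
  finally show "emeasure ds {x. x - s \<in> A} = emeasure ds A" by simp
  show "{x. x - s \<in> A} \<in> sets borel"
    using measurable_sets[OF meas assms(2)] by (simp add: vimage_def)
qed

lemma pi_ideal_borel: "{x. x - a \<in> pi_ideal n} \<in> sets borel" "pi_ideal n \<in> sets borel"
  using open_pi_ideal_coset[of a n] open_pi_ideal_coset[of 0 n] by (auto intro: borel_open)

text \<open>
  \<open>\<pi>\<^sup>n\<O>\<close> is the disjoint union of the translates of \<open>\<pi>\<^bsup>n+1\<^esup>\<O>\<close> indexed by the coefficient of \<open>\<pi>\<^sup>n\<close>.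
\<close>

lemma Haar_pi_ideal_step:
  fixes ds :: "'q::{field,finite} fls measure"
  assumes "normalized_Haar ds"
  shows "emeasure ds (pi_ideal n) = ennreal (real CARD('q)) * emeasure ds (pi_ideal (n + 1))"
proof -
  define P where "P c = {x. x - fls_const c * t_pow (- n) \<in> pi_ideal (n + 1)}" for c :: 'q
  have sets: "sets ds = sets borel" using assms by (simp add: normalized_Haar_def)
  have nth: "x \<in> P c \<longleftrightarrow> x \<in> pi_ideal n \<and> fls_nth x n = c" for x c
  proof -
    have "x \<in> P c \<longleftrightarrow> (\<forall>i<n + 1. fls_nth x i = (if i = n then c else 0))"
      by (auto simp: P_def pi_ideal_def t_pow_nth)
    also have "\<dots> \<longleftrightarrow> x \<in> pi_ideal n \<and> fls_nth x n = c"
      by (auto simp: pi_ideal_def)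
    finally show ?thesis .
  qed
  then have "pi_ideal n = (\<Union>c. P c)" by auto
  then have "emeasure ds (pi_ideal n) = emeasure ds (\<Union>c. P c)" by (rule arg_cong)
  also have "\<dots> = (\<Sum>c\<in>UNIV. emeasure ds (P c))"
  proof (rule sum_emeasure[symmetric])
    show "range P \<subseteq> sets ds" by (auto simp: P_def sets pi_ideal_borel)
    show "disjoint_family_on P UNIV" using nth by (auto simp: disjoint_family_on_def)
  qed simp
  also have "\<dots> = (\<Sum>c\<in>(UNIV :: 'q set). emeasure ds (pi_ideal (n + 1)))"
    unfolding P_def by (intro sum.cong refl normalized_Haar_shift(1)[OF assms pi_ideal_borel(2)])
  finally show ?thesis by (simp add: ennreal_of_nat_eq_real_of_nat)
qed

lemma Haar_pi_ideal:
  fixes ds :: "'q::{field,finite} fls measure"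
  assumes "normalized_Haar ds"
  shows "emeasure ds (pi_ideal n) = ennreal (real CARD('q) powi (- n))"
proof -
  let ?q = "real CARD('q)"
  have q: "?q > 0" by simp
  have 0: "emeasure ds (pi_ideal 0) = ennreal 1"
    using assms by (simp add: normalized_Haar_def int_ring_eq_pi_ideal)
  have up: "emeasure ds (pi_ideal (i + 1)) = ennreal (?q powi (- (i + 1)))"
    if "emeasure ds (pi_ideal i) = ennreal (?q powi (- i))" for i
  proof -
    have "emeasure ds (pi_ideal (i + 1)) = ennreal (1 / ?q) * (ennreal ?q * emeasure ds (pi_ideal (i + 1)))"
      using q by (simp add: mult.assoc[symmetric] ennreal_mult'[symmetric] del: of_nat_0_less_iff)
    also have "\<dots> = ennreal (1 / ?q) * ennreal (?q powi (- i))"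
      using Haar_pi_ideal_step[OF assms, of i] that by simp
    also have "\<dots> = ennreal (?q powi (- i) / ?q)"
      using q by (simp add: ennreal_mult'[symmetric])
    also have "?q powi (- i) / ?q = ?q powi (- i - 1)"
      by (rule power_int_diff[of ?q "- i" 1, simplified, symmetric])
    finally have "emeasure ds (pi_ideal (i + 1)) = ennreal (?q powi (- i - 1))" .
    moreover have "- (i + 1) = - i - 1" by simp
    ultimately show ?thesis by (simp only:)
  qed
  have down: "emeasure ds (pi_ideal (i - 1)) = ennreal (?q powi (- (i - 1)))"
    if "emeasure ds (pi_ideal i) = ennreal (?q powi (- i))" for i
  proof -
    have "emeasure ds (pi_ideal (i - 1)) = ennreal ?q * ennreal (?q powi (- i))"
      using Haar_pi_ideal_step[OF assms, of "i - 1"] that by simp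
    also have "\<dots> = ennreal (?q * ?q powi (- i))"
      by (rule ennreal_mult[symmetric]) auto
    also have "?q * ?q powi (- i) = ?q powi (- (i - 1))"
      using power_int_add[of ?q 1 "- i"] by simp
    finally show ?thesis .
  qed
  show ?thesis
    by (induction n rule: int_induct[where k = 0]) (use 0 up down in \<open>auto\<close>)
qed

text \<open>
  Both measures are the sum over \<open>l\<close> in \<open>L\<close> of the measures of \<open>D \<inter> (l + E)\<close>: these pieces partition
  \<open>D\<close>, and their translates \<open>(D - l) \<inter> E\<close> partition \<open>E\<close>. Hence the covolume is well defined.
\<close>

lemma fundamental_domains_measure_eq:
  fixes ds :: "'q::{field,finite} fls measure"
  assumes Haar: "normalized_Haar ds"
    and L: "countable L" "\<And>x. x \<in> L \<Longrightarrow> - x \<in> L"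
    and D: "D \<in> sets borel" "\<And>s. \<exists>!d. d \<in> D \<and> s - d \<in> L"
    and E: "E \<in> sets borel" "\<And>s. \<exists>!d. d \<in> E \<and> s - d \<in> L"
  shows "emeasure ds D = emeasure ds E"
proof -
  have sets: "sets ds = sets borel" using Haar by (simp add: normalized_Haar_def)
  have shift: "{x. x - l \<in> A} \<in> sets borel" if "A \<in> sets borel" for A :: "'q fls set" and l
    by (rule normalized_Haar_shift(2)[OF Haar that])
  have split: "emeasure ds A = (\<integral>\<^sup>+l. emeasure ds {x \<in> A. x - l \<in> B} \<partial>count_space L)"
    if A: "A \<in> sets borel" and B: "B \<in> sets borel" "\<And>s. \<exists>!d. d \<in> B \<and> s - d \<in> L" for A B
  proof -
    have un: "A = (\<Union>l\<in>L. {x \<in> A. x - l \<in> B})"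
    proof (intro equalityI subsetI)
      fix x assume "x \<in> A"
      from B(2)[of x] obtain d where "d \<in> B" "x - d \<in> L" by blast
      with \<open>x \<in> A\<close> show "x \<in> (\<Union>l\<in>L. {x \<in> A. x - l \<in> B})"
        by (intro UN_I[of "x - d"]) auto
    qed auto
    have "emeasure ds A = emeasure ds (\<Union>l\<in>L. {x \<in> A. x - l \<in> B})"
      using un by simp
    also have "\<dots> = (\<integral>\<^sup>+l. emeasure ds {x \<in> A. x - l \<in> B} \<partial>count_space L)"
    proof (rule emeasure_UN_countable)
      show "{x \<in> A. x - l \<in> B} \<in> sets ds" if "l \<in> L" for l
        using sets.Int[OF A shift[OF B(1), of l]] by (simp add: sets Int_def)
      show "disjoint_family_on (\<lambda>l. {x \<in> A. x - l \<in> B}) L"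
        unfolding disjoint_family_on_def
      proof (intro ballI impI equals0I)
        fix l l' x
        assume "l \<in> L" "l' \<in> L" "l \<noteq> l'" "x \<in> {x \<in> A. x - l \<in> B} \<inter> {x \<in> A. x - l' \<in> B}"
        then have "x - l \<in> B \<and> x - (x - l) \<in> L" "x - l' \<in> B \<and> x - (x - l') \<in> L" by auto
        then have "x - l = x - l'" using B(2)[of x] by blast
        with \<open>l \<noteq> l'\<close> show False by simp
      qed
    qed (rule L(1))
    finally show ?thesis .
  qed
  have "emeasure ds D = (\<integral>\<^sup>+l. emeasure ds {x \<in> D. x - l \<in> E} \<partial>count_space L)"
    by (rule split[OF D(1) E])
  also have "\<dots> = (\<integral>\<^sup>+l. emeasure ds {x \<in> E. x - (- l) \<in> D} \<partial>count_space L)"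
  proof (rule nn_integral_cong)
    fix l
    have "{x \<in> E. x - (- l) \<in> D} \<in> sets borel"
      using sets.Int[OF E(1) shift[OF D(1), of "- l"]] by (simp add: Int_def)
    from normalized_Haar_shift(1)[OF Haar this, of l]
    show "emeasure ds {x \<in> D. x - l \<in> E} = emeasure ds {x \<in> E. x - (- l) \<in> D}"
      by (simp add: conj_commute)
  qed
  also have "\<dots> = (\<integral>\<^sup>+l. emeasure ds {x \<in> E. x - l \<in> D} \<partial>count_space L)"
  proof -
    have "bij_betw uminus L L"
      using L(2) by (intro bij_betwI[where g = uminus]) auto
    from nn_integral_bij_count_space[OF this, of "\<lambda>l. emeasure ds {x \<in> E. x - l \<in> D}"]
    show ?thesis .
  qed
  also have "\<dots> = emeasure ds E"
    by (rule split[OF E(1) D, symmetric])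
  finally show ?thesis .
qed

text \<open>
  The set \<open>\<alpha>\<^sup>-\<^sup>2 \<pi> \<O>\<close> is a fundamental domain for the stabilizer \<open>\<alpha>\<^sup>-\<^sup>2 \<F>\<^sub>q[t]\<close>; its measure is
  \<open>q\<^bsup>-2m-1\<^esup>\<close> with \<open>m = deg \<alpha>\<close>.
\<close>

lemma orbit_level_diagonal:
  fixes ds :: "'q::{field,finite} fls measure"
  assumes Haar: "normalized_Haar ds" and \<alpha>: "\<alpha> \<noteq> 0"
  shows "orbit_level ds (U_orbit (Gamma_coset (diag_mat \<alpha>))) = - fls_subdegree \<alpha>"
proof -
  let ?q = "real CARD('q)"
  let ?L = "{s. \<alpha> * \<alpha> * s \<in> poly_ring}"
  let ?D = "pi_ideal (1 - 2 * fls_subdegree \<alpha>) :: 'q fls set"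
  have DL: "s \<in> ?D \<longleftrightarrow> \<alpha> * \<alpha> * s \<in> pi_ideal 1" for s
    using \<alpha> mult_mem_pi_ideal_iff[of "\<alpha> * \<alpha>" s 1] by simp
  have dom: "\<exists>!d. d \<in> ?D \<and> s - d \<in> ?L" for s
  proof (rule ex_ex1I)
    obtain p r where pr: "p \<in> poly_ring" "r \<in> pi_ideal 1" "\<alpha> * \<alpha> * s = p + r"
      by (rule poly_plus_pi_ideal)
    have "s - r / (\<alpha> * \<alpha>) \<in> ?L" "r / (\<alpha> * \<alpha>) \<in> ?D"
      using pr \<alpha> by (simp_all add: DL right_diff_distrib)
    then show "\<exists>d. d \<in> ?D \<and> s - d \<in> ?L" by blast
  next
    fix d e assume *: "d \<in> ?D \<and> s - d \<in> ?L" "e \<in> ?D \<and> s - e \<in> ?L"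
    have "\<alpha> * \<alpha> * (e - d) = \<alpha> * \<alpha> * (s - d) - \<alpha> * \<alpha> * (s - e)"
      by (simp add: algebra_simps)
    with * have "\<alpha> * \<alpha> * (e - d) \<in> poly_ring" by (simp add: poly_ring_diff)
    moreover have "\<alpha> * \<alpha> * (e - d) \<in> pi_ideal 1"
      using * by (simp add: DL right_diff_distrib pi_ideal_diff)
    ultimately have "\<alpha> * \<alpha> * (e - d) = 0" by (rule poly_ring_pi_ideal_eq_0) simp
    with \<alpha> show "d = e" by simp
  qed
  have count: "countable ?L"
  proof -
    have "?L \<subseteq> (\<lambda>p. p / (\<alpha> * \<alpha>)) ` poly_ring"
      using \<alpha> by (auto intro!: image_eqI[of s _ "\<alpha> * \<alpha> * s" for s])
    then show ?thesis by (rule countable_subset) (intro countable_image countable_poly_ring)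
  qed
  have neg: "- x \<in> ?L" if "x \<in> ?L" for x using that by simp
  have cov: "covolume ds ?L = emeasure ds ?D"
    unfolding covolume_def
  proof (rule the_equality)
    show "\<exists>D\<in>sets borel. (\<forall>s. \<exists>!d. d \<in> D \<and> s - d \<in> ?L) \<and> emeasure ds D = emeasure ds ?D"
      using dom pi_ideal_borel(2) by blast
    fix c assume "\<exists>D\<in>sets borel. (\<forall>s. \<exists>!d. d \<in> D \<and> s - d \<in> ?L) \<and> emeasure ds D = c"
    then obtain D where D: "D \<in> sets borel" "\<And>s. \<exists>!d. d \<in> D \<and> s - d \<in> ?L" "c = emeasure ds D"
      by blast
    show "c = emeasure ds ?D"
      unfolding D(3) by (rule fundamental_domains_measure_eq[OF Haar count neg D(1,2) pi_ideal_borel(2) dom])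
  qed
  have cov': "covolume ds ?L = ennreal (?q powi (2 * fls_subdegree \<alpha> - 1))"
    unfolding cov Haar_pi_ideal[OF Haar] by simp
  have inj: "i = j" if "?q powi i = ?q powi j" for i j
    using that power_int_strict_increasing[OF _ card_field_gt_1[where 'q = 'q], of i j]
      power_int_strict_increasing[OF _ card_field_gt_1[where 'q = 'q], of j i]
    by (cases i j rule: linorder_cases) auto
  show ?thesis
    unfolding orbit_level_def Lambda_U_diagonal[OF \<alpha>] cov'
    by (rule the_equality) (auto dest!: inj)
qed

section \<open>Equidistribution of the translated orbit\<close>

lemma coset_prob_orbit:
  assumes "compact_U_orbit Y" "invariant_prob_orbit Y \<nu>"
  shows "coset_prob \<nu> Y"
proof -
  have "Y \<subseteq> X_space"
    using assms(1) compactin_subset_topspace topspace_X_top unfolding compact_U_orbit_def by blast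
  then show ?thesis
    using assms(2) unfolding invariant_prob_orbit_def coset_prob_def coset_prob_axioms_def by blast
qed

text \<open>
  Pushing \<open>a\<^bsub>-n\<^esub>\<close> past the unipotent part of a Hecke representative leaves a translation by \<open>U\<close> on
  the left, which does not change the distribution. What remains of the representative is \<open>a\<^bsub>-1\<^esub>\<close>
  in the first family, and \<open>a\<^sub>1\<close> or, for a nontrivial \<open>l(s)\<close>, a matrix in \<open>U K\<close> in the second. This
  gives the horocycle recursion. For \<open>n \<le> m\<close> all points \<open>y a\<^bsub>-n\<^esub>\<close> have level \<open>m - n\<close>, which supplies
  the initial values.
\<close>

lemma level_prob_orbit:
  fixes Y :: "'q::{field,finite} coset set"
  assumes \<nu>: "coset_prob \<nu> Y" and inv: "\<And>s. distr \<nu> \<nu> (\<lambda>y. right_act y (u_mat s)) = \<nu>"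
    and \<alpha>: "\<alpha> \<noteq> 0" and Y: "Y = U_orbit (Gamma_coset (diag_mat \<alpha>))"
  shows "coset_prob.level_prob \<nu> (a_mat (fls_subdegree \<alpha> - int N)) k =
    horocycle_prob (real CARD('q)) N k"
proof -
  interpret coset_prob \<nu> Y by (rule \<nu>)
  let ?q = "real CARD('q)"
  \<comment> \<open>The index is shifted so that \<open>P n\<close> belongs to \<open>y a\<^bsub>-(m+n)\<^esub>\<close>, where \<open>m\<close> is the degree of \<open>\<alpha>\<close>.\<close>
  define P where "P n = level_prob (a_mat (fls_subdegree \<alpha> - n))" for n
  have closed: "right_act y (u_mat s) \<in> Y" if "y \<in> Y" for y s
    using that by (auto simp: Y U_orbit_def right_act_right_act u_mat_mult)
  have u_inv: "level_prob (a_mat n ** u_mat s ** a_mat j) k = level_prob (a_mat (n + j)) k" for n s j k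
  proof -
    have "a_mat n ** u_mat s ** a_mat j = u_mat (t_pow (2 * n) * s) ** a_mat (n + j)"
      by (simp add: a_u_commute) (simp add: a_mat_mult flip: matrix_mul_assoc)
    then show ?thesis
      using level_prob_invariant[OF elementary_mats_in_SL2(1) closed inv elementary_mats_in_SL2(4)] by simp
  qed
  have start: "P n k = of_bool (int k = - n)" if "n \<le> 0" for n k
  proof -
    have "coset_level (right_act y (a_mat (fls_subdegree \<alpha> - n))) = nat (- n)" if "y \<in> Y" for y
    proof -
      from that obtain s where y: "y = Gamma_coset (diag_mat \<alpha> ** u_mat s)"
        by (auto simp: Y U_orbit_diagonal_iff)
      let ?g = "diag_mat \<alpha> ** u_mat s ** a_mat (fls_subdegree \<alpha> - n)"
      have "?g = u_mat (\<alpha> * \<alpha> * s) ** diag_mat (\<alpha> * t_pow (fls_subdegree \<alpha> - n))"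
        unfolding diag_mat_u_commute[OF \<alpha>] matrix_mul_assoc[symmetric]
        by (rule arg_cong[where f = "(**) _"]) (simp add: a_mat_eq_diag_mat diag_mat_def)
      moreover have "K_coset (u_mat (\<alpha> * \<alpha> * s) ** diag_mat (\<alpha> * t_pow (fls_subdegree \<alpha> - n))) =
          K_coset (u_mat (\<alpha> * \<alpha> * s) ** a_mat (- n))"
        using \<alpha> K_coset_diag_mat[of "\<alpha> * t_pow (fls_subdegree \<alpha> - n)"] by (intro K_coset_left) simp
      ultimately have "level ?g = level (u_mat (\<alpha> * \<alpha> * s) ** a_mat (- n))"
        using level_K_coset by metis
      also have "\<dots> = nat (- n)" using \<open>n \<le> 0\<close> by (intro level_u_a_nonneg) simp
      finally show ?thesis
        using \<alpha> by (simp add: y right_act_Gamma_coset coset_level_Gamma_coset Ggp.mult_closed)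
    qed
    then have "{y \<in> space \<nu>. coset_level (right_act y (a_mat (fls_subdegree \<alpha> - n))) = k} =
        (if int k = - n then space \<nu> else {})"
      using \<open>n \<le> 0\<close> by (auto simp: space_M)
    then show ?thesis by (simp add: P_def level_prob_def prob_space)
  qed
  have rec: "?q\<^sup>2 * P (n + 1) k + P (n - 1) k + (?q - 1) * P n k =
      (if k = 0 then (?q\<^sup>2 - 1) * P n 0
       else if k = 1 then (?q + 1) * P n 0 + (?q - 1) * P n 1
       else P n (k - 1) + (?q - 1) * P n k)
      + ?q\<^sup>2 * P n (k + 1)" for n k
  proof -
    let ?a = "a_mat (fls_subdegree \<alpha> - n) :: 'q mat2"
    have down: "level_prob (?a ** hecke_rep (Inl p)) k = P (n + 1) k" for p :: "'q \<times> 'q"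
      by (cases p) (simp add: matrix_mul_assoc u_inv P_def algebra_simps)
    have up: "level_prob (?a ** hecke_rep (Inr 0)) k = P (n - 1) k"
      unfolding hecke_rep_Inr_0 by (simp add: a_mat_mult P_def algebra_simps)
    have same: "level_prob (?a ** hecke_rep (Inr b)) k = P n k" if "b \<noteq> 0" for b :: 'q
    proof -
      have "level_prob (?a ** hecke_rep (Inr b)) k =
          level_prob (?a ** u_mat (inverse (fls_const b * t_pow (-1)))) k"
        by (intro level_prob_K_coset K_coset_left K_coset_hecke_rep_Inr that Ggp.mult_closed)
          (simp_all del: hecke_rep.simps)
      also have "\<dots> = P n k"
        using u_inv[of _ _ 0] by (simp add: a_mat_0 P_def)
      finally show ?thesis .
    qed
    have "(\<Sum>i\<in>(UNIV :: (('q \<times> 'q) + 'q) set). level_prob (?a ** hecke_rep i) k) =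
        ?q\<^sup>2 * P (n + 1) k + (\<Sum>b\<in>UNIV. level_prob (?a ** hecke_rep (Inr b)) k)"
      unfolding sum_hecke_index down by (simp add: power2_eq_square)
    also have "(\<Sum>b\<in>(UNIV :: 'q set). level_prob (?a ** hecke_rep (Inr b)) k) =
        P (n - 1) k + (\<Sum>b\<in>UNIV - {0 :: 'q}. P n k)"
      by (subst sum.remove[of _ 0]) (simp_all add: up same del: hecke_rep.simps sum_constant)
    also have "(\<Sum>b\<in>UNIV - {0 :: 'q}. P n k) = (?q - 1) * P n k"
      by (simp add: card_Diff_singleton of_nat_diff Suc_le_eq)
    finally show ?thesis
      using hecke_level_prob[of ?a k, OF elementary_mats_in_SL2(4)] unfolding P_def by linarith
  qed
  have "P (int N) k = horocycle_prob ?q N k"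
    by (rule horocycle_prob_unique[OF card_field_gt_1 _ _ rec]) (auto simp: start)
  then show ?thesis by (simp add: P_def)
qed

theorem theorem4p6:
  fixes ds :: "'q::{field,finite} fls measure"
    and \<mu>\<^sub>X \<nu>\<^sub>Y :: "'q coset measure"
    and Y :: "'q coset set"
    and f :: "'q coset \<Rightarrow> complex"
    and \<Phi> :: "nat \<Rightarrow> complex"
    and R n :: nat
  assumes "normalized_Haar ds"
    and "invariant_prob_X \<mu>\<^sub>X"
    and "compact_U_orbit Y"
    and "invariant_prob_orbit Y \<nu>\<^sub>Y"
    and "\<forall>x\<in>X_space. f x = \<Phi> (height_K x)"
    and "right_K_invariant f"
    and "even R"
    and "\<forall>k. even k \<and> \<Phi> k \<noteq> 0 \<longrightarrow> k \<le> R"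
    and "2 * (int n - orbit_level ds Y) - 2 > int R"
  shows "periodic_average \<nu>\<^sub>Y n f = (LINT x|\<mu>\<^sub>X. f x)"
proof -
  let ?q = "real CARD('q)"
  obtain \<alpha> where \<alpha>: "\<alpha> \<noteq> 0" and Y: "Y = U_orbit (Gamma_coset (diag_mat \<alpha>))"
    using compact_U_orbit_diagonal[OF assms(3)] .
  have m: "orbit_level ds Y = - fls_subdegree \<alpha>"
    unfolding Y by (rule orbit_level_diagonal[OF assms(1) \<alpha>])
  interpret X: coset_prob \<mu>\<^sub>X X_space by (rule coset_prob_X[OF assms(2)])
  interpret O: coset_prob \<nu>\<^sub>Y Y by (rule coset_prob_orbit[OF assms(3,4)])
  define N where "N = nat (int n + fls_subdegree \<alpha>)"
  have gap: "int R + 2 < 2 * (int n + fls_subdegree \<alpha>)" using assms(9) unfolding m by simp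
  have "int n + fls_subdegree \<alpha> \<ge> 0"
  proof (rule ccontr)
    assume "\<not> int n + fls_subdegree \<alpha> \<ge> 0"
    with gap have "int R < 0" by simp
    then show False by simp
  qed
  then have N: "int n = int N - fls_subdegree \<alpha>" by (simp add: N_def)
  have "int (R + 2) < int (2 * N)" using gap N by simp
  then have RN: "R + 2 < 2 * N" by (simp only: of_nat_less_iff)
  have f: "f x = \<Phi> (2 * coset_level x)" if "x \<in> X_space" for x
    using assms(5) that height_K_eq_coset_level by metis
  have supp: "\<Phi> (2 * k) = 0" if "k \<ge> N" for k
    using assms(8)[rule_format, of "2 * k"] RN that by auto
  have "(LINT x|\<mu>\<^sub>X. f x) = (\<Sum>k<N. of_real (X.level_prob (mat 1) k) * \<Phi> (2 * k))"
    by (rule X.integral_level_function[OF Ggp.one_closed _ supp]) (auto simp: X.space_M f)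
  moreover have "periodic_average \<nu>\<^sub>Y n f =
      (\<Sum>k<N. of_real (O.level_prob (a_mat (- int n)) k) * \<Phi> (2 * k))"
    unfolding periodic_average_def using O.Z
    by (intro O.integral_level_function supp elementary_mats_in_SL2) (auto simp: O.space_M intro!: f right_act_in_X)
  moreover have "X.level_prob (mat 1) k = O.level_prob (a_mat (- int n)) k" if "k < N" for k
  proof -
    have "distr \<nu>\<^sub>Y \<nu>\<^sub>Y (\<lambda>y. right_act y (u_mat s)) = \<nu>\<^sub>Y" for s
      using assms(4) by (simp add: invariant_prob_orbit_def)
    from level_prob_orbit[OF O.coset_prob_axioms this \<alpha> Y, of N k]
    have "O.level_prob (a_mat (- int n)) k = horocycle_prob ?q N k" by (simp add: N)
    also have "\<dots> = X.level_prob (mat 1) k"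
      using that by (simp add: horocycle_prob_def level_prob_X[OF assms(2)])
    finally show ?thesis by simp
  qed
  ultimately show ?thesis by simp
qed

end
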